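(* Let $X_1,X_2,\dots$ be i.i.d. random variables with characteristic function $\varphi(t)=\mathbb{E}e^{itX_1}$, and let $S_k=\sum_{j=1}^kX_j$. Let $\alpha\in\mathbb{R}$ be irrational such that $\|q\alpha\|\ge Cq^{-\gamma}$ for every $q\in\mathbb{N}$ with some constants $\gamma\ge1$ and $C>0$. (i) Suppose there exist real numbers $0<\beta\le 2$, $c>0$ and an integer $d>0$ such that $1-|\varphi(2\pi x)|\ge c\|dx\|^\beta$ for all $x\in\mathbb{R}$. Let $s=1$ if $0<\beta<2$ and $s=2$ if $\beta=2$. Then almost surely \[ D_N(\{S_k\alpha\}) = O\left(\sqrt{\frac{\log\log N}{N}}\log^s N\right) \text{ if } 1\le\gamma\le 2/\beta, \qquad D_N(\{S_k\alpha\})=O\left(\left(\frac{\log\log N}{N}\right)^{1/(\beta\gamma)}\right) \text{ if } \gamma>2/\beta. \] (ii) Suppose there exist a real number $c>0$ and an integer $d>0$ such that $|\varphi(2\pi x)-\varphi(2\pi y)|\ge c\|d(x-y)\|$ for all $x,y\in\mathbb{R}$. Then almost surely \[ D_N(\{S_k\alpha\}) = O\left(\sqrt{\frac{\log\log N}{N}}\log N\right) \text{ if } 1\le\gamma\le 2, \qquad D_N(\{S_k\alpha\})=O\left(\left(\frac{\log\log N}{N}\right)^{1/\gamma}\right) \text{ if } \gamma>2. \]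
   Context: $\|t\|$ denotes the distance from $t\in\mathbb{R}$ to the nearest integer, $\{\cdot\}$ the fractional part. The discrepancy of a real sequence $(x_k)$ is $D_N(x_k)=\sup_{0\le a<b\le 1}\left|\frac1N\sum_{k=1}^N I_{[a,b)}(\{x_k\})-(b-a)\right|$. "$f(N)=O(g(N))$ a.s." means that with probability one $\limsup_N f(N)/g(N)<\infty$. *)

theory Defs
  imports "HOL-Probability.Probability"
begin

definition dist_int :: "real \<Rightarrow> real" where
  "dist_int t = infdist t \<int>"

definition discrepancy :: "nat \<Rightarrow> (nat \<Rightarrow> real) \<Rightarrow> real" where
  "discrepancy N x =
     (SUP (a, b) \<in> {(a, b). 0 \<le> a \<and> a < b \<and> b \<le> 1}.
        \<bar>1 / real N * (\<Sum>k = 1..N. indicator {a..<b} (frac (x k))) - (b - a)\<bar>)"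

text \<open>The limsup is taken in the extended reals; the values at the finitely many \<open>N\<close> for which
  a bound such as \<open>ln (ln N)\<close> is not positive do not affect it.\<close>

definition as_bigo :: "'a measure \<Rightarrow> (nat \<Rightarrow> 'a \<Rightarrow> real) \<Rightarrow> (nat \<Rightarrow> real) \<Rightarrow> bool" where
  "as_bigo M f g \<longleftrightarrow> (AE \<omega> in M. limsup (\<lambda>N. ereal (f N \<omega> / g N)) < \<infinity>)"

end

theory Submission
  imports Defs
begin

text \<open>
  In both parts the hypothesis on \<open>\<phi>\<close> gives \<open>\<bar>1 - \<phi>(2\<pi>x)\<bar> \<ge> c \<parallel>dx\<parallel>\<^sup>\<beta>\<close>, with \<open>\<beta> = 1\<close> in part (ii),
  and this is all that is needed. Put \<open>Z\<^sub>k = e(h\<alpha>S\<^sub>k)\<close> and \<open>\<phi>\<^sub>h = \<phi>(2\<pi>h\<alpha>)\<close>. The differences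
  \<open>Z\<^sub>k\<^sub>+\<^sub>1 - \<phi>\<^sub>h Z\<^sub>k\<close> are bounded martingale differences of conditional variance
  \<open>1 - \<bar>\<phi>\<^sub>h\<bar>\<^sup>2 \<le> 2 \<bar>1 - \<phi>\<^sub>h\<bar>\<close>, and their sum is \<open>(1 - \<phi>\<^sub>h) \<Sum>Z\<^sub>k\<close> up to a bounded error. Hence the maximum
  over \<open>n \<le> N\<close> of \<open>\<bar>\<Sum>\<^sub>k\<^sub>\<le>\<^sub>n Z\<^sub>k\<bar>\<close>, divided by \<open>(N / \<bar>1 - \<phi>\<^sub>h\<bar>)\<^sup>1\<^sup>/\<^sup>2\<close>, has an exponential moment of order \<open>\<surd>L\<close>
  bounded by \<open>A exp(A L)\<close> with an absolute constant \<open>A\<close>. By convexity of \<open>exp\<close> the same bound holds for weighted averages over \<open>h\<close>;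
  with \<open>N = 2\<^sup>k\<close> and \<open>L = ln k\<close> the Borel--Cantelli lemma gives the factor \<open>ln ln N\<close> uniformly in \<open>h\<close>,
  without a union bound. The Erdos--Turan inequality reduces the discrepancy to
  \<open>1/H + (ln ln N / N)\<^sup>1\<^sup>/\<^sup>2 \<Sum>\<^sub>h\<^sub>\<le>\<^sub>H 1 / (h \<parallel>dh\<alpha>\<parallel>\<^sup>\<beta>\<^sup>/\<^sup>2)\<close>, and the last sum is estimated by splitting \<open>h\<close> into residue
  classes modulo the denominator of a Dirichlet approximation of \<open>d\<alpha>\<close>.
\<close>

section \<open>The Erdos--Turan inequality\<close>

lemma cis_linear_has_vector_derivative:
  "((\<lambda>t. cis (a * t)) has_vector_derivative a *\<^sub>R (\<i> * cis (a * t))) (at t within T)"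
  unfolding has_vector_derivative_def
  by (auto intro!: derivative_eq_intros simp: scaleR_conv_of_real algebra_simps)

lemma cis_int_periodic:
  fixes h k :: int
  shows "cis (2 * pi * h * (y + of_int k)) = cis (2 * pi * h * y)"
proof -
  have "cis (2 * pi * h * (y + of_int k)) = cis (2 * pi * h * y) * cis (2 * pi * of_int (h * k))"
    by (simp add: cis_mult algebra_simps)
  then show ?thesis by (simp only: cis_multiple_2pi Ints_of_int mult_1_right)
qed

text \<open>The primitive \<open>P\<close> comes from one integration by parts. The constant
  \<open>c\<close> stays free because the sawtooth follows two different lines on the two sides of
  its jump.\<close>

lemma has_integral_linear_cis:
  fixes h :: int and a b c :: real
  assumes "a \<le> b" "h \<noteq> 0"
  defines "P \<equiv> \<lambda>t. of_real (c - t) * (cis (2 * pi * h * t) / (2 * pi * h * \<i>))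
                    + cis (2 * pi * h * t) / (2 * pi * h * \<i>)\<^sup>2"
  shows "((\<lambda>t. of_real (c - t) * cis (2 * pi * h * t)) has_integral (P b - P a)) {a..b}"
proof (rule fundamental_theorem_of_calculus[OF assms(1)])
  fix t assume "t \<in> {a..b}"
  note [derivative_intros] = cis_linear_has_vector_derivative[of "2 * pi * h"]
  show "(P has_vector_derivative of_real (c - t) * cis (2 * pi * h * t)) (at t within {a..b})"
    unfolding P_def
    by (rule derivative_eq_intros | simp)+
      (use assms in \<open>simp add: scaleR_conv_of_real field_simps power2_eq_square\<close>)
qed

text \<open>Reducing \<open>y\<close> modulo 1 to \<open>z\<close> in [-1/2, 1/2) places the jump of
  the sawtooth at t = \<open>z\<close>. For h \<noteq> 0 the terms at the two endpoints cancel by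
  periodicity, and the unit jump leaves \<open>- E z\<close>.\<close>

lemma has_integral_sawtooth_cis:
  fixes h :: int and y :: real
  shows "((\<lambda>t. of_real (frac (y - t) - 1/2) * cis (2 * pi * h * t)) has_integral
           (if h = 0 then 0 else - cis (2 * pi * h * y) / (2 * pi * h * \<i>))) {-1/2..1/2}"
proof -
  define z where "z = frac (y + 1/2) - 1/2"
  define k where "k = \<lfloor>y + 1/2\<rfloor>"
  have y: "y = z + of_int k" by (simp add: z_def k_def frac_def)
  have z: "-1/2 \<le> z" "z < 1/2"
    using frac_ge_0[of "y+1/2"] frac_lt_1[of "y+1/2"] by (auto simp: z_def)
  have left: "frac (y - t) = z - t" if "t \<in> {-1/2..z}" for t
    using that z by (auto simp: frac_unique_iff y)
  have right: "frac (y - t) = z - t + 1" if "t \<in> {z..1/2} - {z}" for t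
    using that z by (auto simp: frac_unique_iff y)
  have cisy: "cis (2 * pi * h * y) = cis (2 * pi * h * z)"
    unfolding y by (rule cis_int_periodic)
  show ?thesis
  proof (cases "h = 0")
    case True
    have int: "((\<lambda>t. c - t) has_integral ((c * v - v\<^sup>2 / 2) - (c * u - u\<^sup>2 / 2))) {u..v}"
      if "u \<le> v" for c u v :: real
      by (rule fundamental_theorem_of_calculus[OF that])
        (auto intro!: derivative_eq_intros simp: has_real_derivative_iff_has_vector_derivative[symmetric])
    have 1: "((\<lambda>t. frac (y - t) - 1/2) has_integral
       ((z - 1/2) * z - z\<^sup>2 / 2) - ((z - 1/2) * (-1/2) - (-1/2)\<^sup>2 / 2)) {-1/2..z}"
      by (rule has_integral_eq[OF _ int[OF z(1)]]) (auto simp: left)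
    \<comment> \<open>At t = \<open>z\<close> the sawtooth still has the value of its left branch,
      so the right branch is integrated up to a one-point exceptional set.\<close>
    have 2: "((\<lambda>t. frac (y - t) - 1/2) has_integral
       ((z + 1/2) * (1/2) - (1/2)\<^sup>2 / 2) - ((z + 1/2) * z - z\<^sup>2 / 2)) {z..1/2}"
      by (rule has_integral_spike_finite[OF _ _ int[of z "1/2" "z + 1/2"], of "{z}"])
        (use z in \<open>auto simp: right\<close>)
    have "((\<lambda>t. frac (y - t) - 1/2) has_integral 0) {-1/2..1/2}"
      by (rule has_integral_eq_rhs[OF has_integral_combine[OF _ _ 1 2]])
        (use z in \<open>auto simp: field_simps power2_eq_square\<close>)
    from has_integral_linear[OF this bounded_linear_of_real[where 'a=complex]] show ?thesis
      using True by (simp add: o_def)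
  next
    case False
    define E where "E = (\<lambda>t. cis (2 * pi * h * t) / (2 * pi * h * \<i>))"
    define E2 where "E2 = (\<lambda>t. cis (2 * pi * h * t) / (2 * pi * h * \<i>)\<^sup>2)"
    note int = has_integral_linear_cis[OF _ False]
    have cis_half: "cis (2 * pi * h * (1/2)) = cis (2 * pi * h * (-1/2))"
      using cis_int_periodic[of h "-1/2" 1] by simp
    have half: "E (1/2) = E (-1/2)" "E2 (1/2) = E2 (-1/2)"
      unfolding E_def E2_def by (simp_all only: cis_half)
    have 1: "((\<lambda>t. of_real (frac (y - t) - 1/2) * cis (2 * pi * h * t)) has_integral
       ((of_real (z - 1/2 - z) * E z + E2 z) - (of_real (z - 1/2 - (-1/2)) * E (-1/2) + E2 (-1/2)))) {-1/2..z}"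
      unfolding E_def E2_def
      by (rule has_integral_eq[OF _ int[OF z(1)]]) (auto simp: left algebra_simps)
    have 2: "((\<lambda>t. of_real (frac (y - t) - 1/2) * cis (2 * pi * h * t)) has_integral
       ((of_real (z + 1/2 - 1/2) * E (1/2) + E2 (1/2)) - (of_real (z + 1/2 - z) * E z + E2 z))) {z..1/2}"
      unfolding E_def E2_def
      by (rule has_integral_spike_finite[OF _ _ int[of z "1/2" "z + 1/2"], of "{z}"])
        (use z in \<open>auto simp: right algebra_simps\<close>)
    have "((\<lambda>t. of_real (frac (y - t) - 1/2) * cis (2 * pi * h * t)) has_integral (- E z)) {-1/2..1/2}"
      by (rule has_integral_eq_rhs[OF has_integral_combine[OF _ _ 1 2]])
        (use z in \<open>auto simp: half algebra_simps\<close>)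
    then show ?thesis using False by (simp add: E_def cisy)
  qed
qed

lemma has_integral_cis_period:
  fixes h :: int
  shows "((\<lambda>t. cis (2 * pi * h * t)) has_integral (if h = 0 then 1 else 0)) {-1/2..1/2}"
proof (cases "h = 0")
  case True
  show ?thesis using has_integral_const_real[of "1::complex" "-1/2" "1/2"] True by simp
next
  case False
  have "((\<lambda>t. cis (2 * pi * h * t)) has_integral
     (cis (2 * pi * h * (1/2)) / (2 * pi * h * \<i>) - cis (2 * pi * h * (-1/2)) / (2 * pi * h * \<i>))) {-1/2..1/2}"
  proof (rule fundamental_theorem_of_calculus)
    fix t :: real
    note [derivative_intros] = cis_linear_has_vector_derivative[of "2 * pi * h"]
    show "((\<lambda>t. cis (2 * pi * h * t) / (2 * pi * h * \<i>)) has_vector_derivative cis (2 * pi * h * t))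
            (at t within {-1/2..1/2})"
      by (rule derivative_eq_intros | simp)+
        (use False in \<open>simp add: scaleR_conv_of_real field_simps\<close>)
  qed simp
  moreover have "cis (2 * pi * h * (1/2)) = cis (2 * pi * h * (-1/2))"
    using cis_int_periodic[of h "-1/2" 1] by simp
  ultimately show ?thesis using False by simp
qed

section \<open>The Fejer kernel\<close>

definition fejer_kernel :: "nat \<Rightarrow> real \<Rightarrow> real" where
  "fejer_kernel n t = (cmod (\<Sum>j<n. cis (2 * pi * real j * t)))\<^sup>2 / real n"

lemma fejer_kernel_nonneg: "fejer_kernel n t \<ge> 0"
  by (simp add: fejer_kernel_def)

text \<open>The double sum stands for the usual triangular weights: the frequency h occurs n - |h|
  times as a difference. It is integrated term by term without any reindexing.\<close>

lemma fejer_kernel_expand: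
  "of_real (fejer_kernel n t) =
     (1 / of_nat n) * (\<Sum>j<n. \<Sum>l<n. cis (2 * pi * of_int (int j - int l) * t))"
proof -
  have "of_real ((cmod (\<Sum>j<n. cis (2 * pi * real j * t)))\<^sup>2) =
      (\<Sum>j<n. cis (2 * pi * real j * t)) * cnj (\<Sum>j<n. cis (2 * pi * real j * t))"
    by (metis complex_norm_square of_real_power)
  also have "\<dots> = (\<Sum>j<n. \<Sum>l<n. cis (2 * pi * of_int (int j - int l) * t))"
    by (simp add: sum_product cis_cnj cis_mult algebra_simps)
  finally show ?thesis by (simp add: fejer_kernel_def)
qed

text \<open>Concavity puts the sine above its chord over [0, pi/2]; \<open>2 * x\<close> is the
  position along that chord.\<close>

lemma sin_ge_jordan:
  fixes x :: real assumes "0 \<le> x" "x \<le> 1/2" shows "2 * x \<le> sin (pi * x)"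
proof -
  have "concave_on {0..pi/2} sin"
    by (rule f''_le0_imp_concave[where f'=cos and f''="\<lambda>x. - sin x"])
      (auto intro!: derivative_eq_intros sin_ge_zero)
  from concave_onD[OF this, of "2*x" 0 "pi/2"] assms show ?thesis
    by (simp add: field_simps)
qed

lemma norm_cis_minus_1: "cmod (cis x - 1) = 2 * \<bar>sin (x / 2)\<bar>"
proof -
  have "(cmod (cis x - 1))\<^sup>2 = (cos x - 1)\<^sup>2 + (sin x)\<^sup>2"
    by (simp add: cmod_power2)
  also have "\<dots> = 2 - 2 * cos (2 * (x/2))"
    using sin_cos_squared_add[of x] by (simp add: power2_eq_square algebra_simps)
  also have "\<dots> = (2 * \<bar>sin (x / 2)\<bar>)\<^sup>2"
    unfolding cos_double_sin by (simp add: power2_eq_square)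
  finally show ?thesis by (rule power2_eq_imp_eq) simp_all
qed

text \<open>The geometric sum has modulus at most 2 / (4|t|), which gives 1 / (4 n t^2). As a \<le>
  |t|, this can be weakened to a multiple of 1 / (t^2 + a^2), which is smooth on the whole period
  and has an arctangent as primitive.\<close>

lemma fejer_kernel_tail:
  assumes "n > 0" "0 < a" "a \<le> \<bar>t\<bar>" "\<bar>t\<bar> \<le> 1/2"
  shows "fejer_kernel n t \<le> 1 / (2 * real n * (t\<^sup>2 + a\<^sup>2))"
proof -
  have "cmod (cis (2 * pi * t) - 1) = 2 * \<bar>sin (pi * t)\<bar>"
    by (simp add: norm_cis_minus_1)
  also have "\<bar>sin (pi * t)\<bar> = sin (pi * \<bar>t\<bar>)"
  proof -
    have "sin (pi * \<bar>t\<bar>) \<ge> 0"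
      using sin_ge_jordan[of "\<bar>t\<bar>"] assms by simp
    then show ?thesis by (cases "t \<ge> 0") auto
  qed
  also have "2 * sin (pi * \<bar>t\<bar>) \<ge> 4 * \<bar>t\<bar>"
    using sin_ge_jordan[of "\<bar>t\<bar>"] assms by simp
  finally have low: "cmod (cis (2 * pi * t) - 1) \<ge> 4 * \<bar>t\<bar>" .
  have tp: "\<bar>t\<bar> > 0" using assms by linarith
  have "(\<Sum>j<n. cis (2 * pi * real j * t)) = (\<Sum>j<n. cis (2 * pi * t) ^ j)"
    by (rule sum.cong) (simp_all add: Complex.DeMoivre mult_ac)
  also have "\<dots> = (cis (2 * pi * t) ^ n - 1) / (cis (2 * pi * t) - 1)"
    using low tp by (intro geometric_sum) auto
  finally have "cmod (\<Sum>j<n. cis (2 * pi * real j * t)) =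
      cmod (cis (2 * pi * t) ^ n - 1) / cmod (cis (2 * pi * t) - 1)"
    by (simp add: norm_divide)
  also have "\<dots> \<le> 2 / (4 * \<bar>t\<bar>)"
    using norm_triangle_ineq4[of "cis (2 * pi * t) ^ n" 1] low tp
    by (intro frac_le) (auto simp: norm_power)
  finally have "(cmod (\<Sum>j<n. cis (2 * pi * real j * t)))\<^sup>2 \<le> (2 / (4 * \<bar>t\<bar>))\<^sup>2"
    by (intro power_mono) auto
  also have "\<dots> = 1 / (4 * t\<^sup>2)" by (simp add: power2_eq_square)
  also have "\<dots> \<le> 1 / (2 * (t\<^sup>2 + a\<^sup>2))"
  proof -
    have "a\<^sup>2 \<le> t\<^sup>2" using power_mono[OF assms(3), of 2] assms by simp
    then show ?thesis using tp assms by (intro divide_left_mono mult_pos_pos add_pos_pos) auto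
  qed
  finally have "(cmod (\<Sum>j<n. cis (2 * pi * real j * t)))\<^sup>2 / n \<le> 1 / (2 * (t\<^sup>2 + a\<^sup>2)) / n"
    by (rule divide_right_mono) simp
  then show ?thesis by (simp add: fejer_kernel_def mult_ac)
qed

lemma has_integral_fejer_kernel:
  assumes "n > 0" shows "(fejer_kernel n has_integral 1) {-1/2..1/2}"
proof -
  have "((\<lambda>t. (1 / of_nat n) * (\<Sum>j<n. \<Sum>l<n. cis (2 * pi * of_int (int j - int l) * t))) has_integral
     (1 / of_nat n) * (\<Sum>j<n. \<Sum>l<n. if int j - int l = 0 then 1 else (0::complex))) {-1/2..1/2}"
    by (intro has_integral_mult_right has_integral_sum has_integral_cis_period) auto
  also have "(\<Sum>j<n. \<Sum>l<n. if int j - int l = 0 then 1 else (0::complex)) = of_nat n"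
    by simp
  finally have "((\<lambda>t. complex_of_real (fejer_kernel n t)) has_integral 1) {-1/2..1/2}"
    using assms by (simp add: fejer_kernel_expand)
  from has_integral_Re[OF this] show ?thesis by simp
qed

lemma has_integral_inverse_quadratic:
  fixes a :: real
  assumes "a > 0"
  shows "((\<lambda>t. 1 / (t\<^sup>2 + a\<^sup>2)) has_integral (arctan (1 / (2 * a)) / a - arctan (- 1 / (2 * a)) / a)) {-1/2..1/2}"
proof -
  have "((\<lambda>t. 1 / (t\<^sup>2 + a\<^sup>2)) has_integral (arctan (1/2 / a) / a - arctan (-1/2 / a) / a)) {-1/2..1/2}"
  proof (rule fundamental_theorem_of_calculus)
    fix t :: real
    have "t\<^sup>2 + a\<^sup>2 > 0" using assms by (simp add: add_nonneg_pos)
    moreover have "1 + (t / a)\<^sup>2 = (t\<^sup>2 + a\<^sup>2) / a\<^sup>2"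
      using assms by (simp add: field_simps)
    ultimately have "((\<lambda>t. arctan (t / a) / a) has_real_derivative 1 / (t\<^sup>2 + a\<^sup>2)) (at t within {-1/2..1/2})"
      using assms by (auto intro!: derivative_eq_intros simp: power2_eq_square)
    then show "((\<lambda>t. arctan (t / a) / a) has_vector_derivative 1 / (t\<^sup>2 + a\<^sup>2)) (at t within {-1/2..1/2})"
      by (simp add: has_real_derivative_iff_has_vector_derivative)
  qed simp
  then show ?thesis by simp
qed

section \<open>From Fejer smoothing to the discrepancy\<close>

text \<open>A function that falls at rate at most 1 stays above g(x) - 2a on [x, x + 2a]. Averaging
  it against the Fejer kernel centred at x + a therefore recovers g(x) up to 2a and up to the mass
  of the kernel outside the window, weighted with 2B.\<close>

lemma fejer_one_sided_bound:
  fixes g :: "real \<Rightarrow> real" and n :: nat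
  assumes n: "n > 0"
    and desc: "\<And>x t. t \<ge> 0 \<Longrightarrow> g (x + t) \<ge> g x - t"
    and bound: "\<And>x. \<bar>g x\<bar> \<le> B"
    and conv: "\<And>x. \<exists>I. ((\<lambda>t. g (x + t) * fejer_kernel n t) has_integral I) {-1/2..1/2} \<and> I \<le> R"
  shows "g x \<le> 4 * pi / n + B / 2 + R"
proof -
  \<comment> \<open>This width makes the tail loss (B/n)(pi/a) equal to B/2, small enough to be
    absorbed when B is the supremum of |g|, and turns 2a into 4 pi / n.\<close>
  define a where "a = 2 * pi / n"
  have a: "a > 0" using n by (simp add: a_def)
  have B0: "B \<ge> 0" using bound[of 0] by linarith
  obtain I where I: "((\<lambda>t. g (x + a + t) * fejer_kernel n t) has_integral I) {-1/2..1/2}" "I \<le> R"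
    using conv by blast
  have J: "((\<lambda>t. (g x - 2 * a) * fejer_kernel n t - (B / n) * (1 / (t\<^sup>2 + a\<^sup>2))) has_integral
     (g x - 2 * a) * 1 - (B / n) * (arctan (1 / (2 * a)) / a - arctan (- 1 / (2 * a)) / a)) {-1/2..1/2}"
    by (intro has_integral_diff has_integral_mult_right has_integral_fejer_kernel
        has_integral_inverse_quadratic n a)
  have "(g x - 2 * a) * 1 - (B / n) * (arctan (1 / (2 * a)) / a - arctan (- 1 / (2 * a)) / a) \<le> I"
  proof (rule has_integral_le[OF J I(1)])
    fix t :: real assume t: "t \<in> {-1/2..1/2}"
    show "(g x - 2 * a) * fejer_kernel n t - (B / n) * (1 / (t\<^sup>2 + a\<^sup>2)) \<le> g (x + a + t) * fejer_kernel n t"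
    \<comment> \<open>The tail correction is subtracted on the whole period. Inside the window it
      only helps; outside it pays for a drop of at most 2B.\<close>
    proof (cases "\<bar>t\<bar> \<le> a")
      case True
      then have "g x - 2 * a \<le> g (x + a + t)"
        using desc[of "a + t" x] by (auto simp: add.assoc abs_le_iff)
      then have "(g x - 2 * a) * fejer_kernel n t \<le> g (x + a + t) * fejer_kernel n t"
        by (intro mult_right_mono fejer_kernel_nonneg)
      moreover have "(B / n) * (1 / (t\<^sup>2 + a\<^sup>2)) \<ge> 0"
        using B0 by simp
      ultimately show ?thesis by linarith
    next
      case False
      then have F: "fejer_kernel n t \<le> 1 / (2 * real n * (t\<^sup>2 + a\<^sup>2))"
        using t a n by (intro fejer_kernel_tail) auto
      have "(g x - 2 * a - g (x + a + t)) * fejer_kernel n t \<le> (2 * B) * fejer_kernel n t"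
        using bound[of x] bound[of "x + a + t"] a by (intro mult_right_mono fejer_kernel_nonneg) linarith
      also have "\<dots> \<le> (2 * B) * (1 / (2 * real n * (t\<^sup>2 + a\<^sup>2)))"
        using F B0 by (intro mult_left_mono) auto
      also have "\<dots> = (B / n) * (1 / (t\<^sup>2 + a\<^sup>2))" using n by simp
      finally show ?thesis by (simp add: algebra_simps)
    qed
  qed
  moreover have "(B / n) * (arctan (1 / (2 * a)) / a - arctan (- 1 / (2 * a)) / a) \<le> (B / n) * (pi / a)"
  proof -
    have "arctan (1 / (2 * a)) - arctan (- 1 / (2 * a)) \<le> pi"
      using arctan_bounded[of "1 / (2 * a)"] arctan_bounded[of "- 1 / (2 * a)"] by linarith
    then show ?thesis using a B0 n
      by (intro mult_left_mono) (auto simp: diff_divide_distrib[symmetric] divide_right_mono)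
  qed
  moreover have "(B / n) * (pi / a) = B / 2" using n by (simp add: a_def)
  ultimately show ?thesis using I(2) by (simp add: a_def)
qed

text \<open>\<open>G\<close> can jump up but falls at rate at most 1, so the one-sided smoothing
  bound applies to it and to its reflection \<open>- G (- v)\<close>. The smoothed function contains
  only frequencies below n, which gives \<open>R\<close>. Both bounds contain half of the supremum
  of |G|, which is then absorbed.\<close>

lemma erdos_turan_sawtooth:
  fixes x :: "nat \<Rightarrow> real" and N n :: nat
  assumes N: "N > 0" and n: "n > 0"
  defines "G \<equiv> \<lambda>u. (\<Sum>k=1..N. frac (x k - u) - 1/2) / real N"
  defines "R \<equiv> (\<Sum>h=1..<n. cmod (\<Sum>k=1..N. cis (2 * pi * real h * x k)) / real h) / (pi * real N)"
  shows "\<bar>G u\<bar> \<le> 8 * pi / n + 2 * R"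
proof -
  define W where "W = (\<lambda>h::int. cmod (\<Sum>k=1..N. cis (2 * pi * h * x k)))"
  have W_neg: "W (-h) = W h" for h
  proof -
    have "(\<Sum>k=1..N. cis (2 * pi * (-h) * x k)) = cnj (\<Sum>k=1..N. cis (2 * pi * h * x k))"
      by (simp add: cis_cnj)
    then show ?thesis unfolding W_def by (simp only: complex_mod_cnj of_int_minus)
  qed
  \<comment> \<open>The modulus of the h-th Fourier coefficient of \<open>G\<close>. The frequency 0
    drops out because the sawtooth has mean zero.\<close>
  define f where "f = (\<lambda>h::int. if h = 0 then 0 else W h / (2 * pi * \<bar>h\<bar> * N))"
  have f_nonneg: "f h \<ge> 0" for h by (simp add: f_def W_def)
  have R_eq: "R = 2 * (\<Sum>h=1..<n. f (int h))"
    unfolding R_def sum_divide_distrib sum_distrib_left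
    by (intro sum.cong refl) (auto simp: f_def W_def)
  \<comment> \<open>For fixed j the differences j - l hit every frequency at most once; the positive
    and the negative ones each contribute at most R/2.\<close>
  have inner: "(\<Sum>l<n. f (int j - int l)) \<le> R" if "j < n" for j
  proof -
    have split: "{..<n} = {..<j} \<union> {j} \<union> {j<..<n}" using that by auto
    have "(\<Sum>l<n. f (int j - int l)) = (\<Sum>l<j. f (int j - int l)) + f 0 + (\<Sum>l\<in>{j<..<n}. f (int j - int l))"
      unfolding split by (subst sum.union_disjoint; (subst sum.union_disjoint)?; auto)
    also have "f 0 = 0" by (simp add: f_def)
    also have "(\<Sum>l<j. f (int j - int l)) \<le> (\<Sum>h=1..<n. f (int h))"
    proof (rule sum_le_included[where i="\<lambda>h. j - h"])
      show "\<forall>l\<in>{..<j}. \<exists>h\<in>{1..<n}. j - h = l \<and> f (int j - int l) \<le> f (int h)"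
      proof
        fix l assume "l \<in> {..<j}"
        then show "\<exists>h\<in>{1..<n}. j - h = l \<and> f (int j - int l) \<le> f (int h)"
          using that by (intro bexI[of _ "j - l"]) (auto simp: of_nat_diff)
      qed
    qed (auto simp: f_nonneg)
    also have "(\<Sum>l\<in>{j<..<n}. f (int j - int l)) \<le> (\<Sum>h=1..<n. f (int h))"
    proof (rule sum_le_included[where i="\<lambda>h. j + h"])
      show "\<forall>l\<in>{j<..<n}. \<exists>h\<in>{1..<n}. j + h = l \<and> f (int j - int l) \<le> f (int h)"
      proof
        fix l assume l: "l \<in> {j<..<n}"
        have "f (int j - int l) = f (int (l - j))"
          using l W_neg[of "int l - int j"] by (auto simp: f_def of_nat_diff)
        then show "\<exists>h\<in>{1..<n}. j + h = l \<and> f (int j - int l) \<le> f (int h)"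
          using l by (intro bexI[of _ "l - j"]) auto
      qed
    qed (auto simp: f_nonneg)
    finally show ?thesis by (simp add: R_eq)
  qed
  \<comment> \<open>The factor \<open>s\<close> is 1 for \<open>G\<close> and -1 for its
    reflection.\<close>
  have conv: "\<exists>I. ((\<lambda>t. G (s * v + t) * fejer_kernel n t) has_integral I) {-1/2..1/2} \<and> \<bar>I\<bar> \<le> R" for v s
  proof -
    define c where "c = (\<lambda>k (h::int). if h = 0 then 0 else
       - cis (2 * pi * h * (x k - s * v)) / (2 * pi * h * \<i>))"
    define I where "I = 1 / of_nat N * (1 / of_nat n) * (\<Sum>j<n. \<Sum>l<n. \<Sum>k=1..N. c k (int j - int l))"
    have "((\<lambda>t. 1 / of_nat N * (1 / of_nat n) * (\<Sum>j<n. \<Sum>l<n. \<Sum>k=1..N.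
         of_real (frac ((x k - s * v) - t) - 1/2) * cis (2 * pi * of_int (int j - int l) * t))) has_integral I) {-1/2..1/2}"
      unfolding I_def c_def by (intro has_integral_mult_right has_integral_sum has_integral_sawtooth_cis) auto
    also have "(\<lambda>t. 1 / of_nat N * (1 / of_nat n) * (\<Sum>j<n. \<Sum>l<n. \<Sum>k=1..N.
         of_real (frac ((x k - s * v) - t) - 1/2) * cis (2 * pi * of_int (int j - int l) * t)))
       = (\<lambda>t. complex_of_real (G (s * v + t) * fejer_kernel n t))"
    proof
      fix t
      have "(\<Sum>j<n. \<Sum>l<n. \<Sum>k=1..N.
         of_real (frac ((x k - s * v) - t) - 1/2) * cis (2 * pi * of_int (int j - int l) * t))
         = (\<Sum>k=1..N. complex_of_real (frac ((x k - s * v) - t) - 1/2)) *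
           (\<Sum>j<n. \<Sum>l<n. cis (2 * pi * of_int (int j - int l) * t))"
        by (simp only: sum_distrib_left sum_distrib_right)
      then show "1 / of_nat N * (1 / of_nat n) * (\<Sum>j<n. \<Sum>l<n. \<Sum>k=1..N.
         of_real (frac ((x k - s * v) - t) - 1/2) * cis (2 * pi * of_int (int j - int l) * t))
        = complex_of_real (G (s * v + t) * fejer_kernel n t)"
        by (simp add: fejer_kernel_expand G_def diff_diff_eq)
    qed
    finally have int: "((\<lambda>t. complex_of_real (G (s * v + t) * fejer_kernel n t)) has_integral I) {-1/2..1/2}" .
    have "cmod (\<Sum>k=1..N. c k h) / N = f h" for h
    proof (cases "h = 0")
      case False
      have "(\<Sum>k=1..N. c k h) = (- cis (- (2 * pi * h * (s * v))) / (2 * pi * h * \<i>)) * (\<Sum>k=1..N. cis (2 * pi * h * x k))"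
        unfolding sum_distrib_left
        by (intro sum.cong refl) (use False in \<open>simp add: c_def cis_mult algebra_simps\<close>)
      then show ?thesis using False by (simp add: f_def W_def norm_mult norm_divide abs_mult)
    qed (simp add: c_def f_def)
    then have cf: "cmod (\<Sum>k=1..N. c k h) = N * f h" for h using N by (simp add: field_simps)
    have "cmod I = 1 / N * (1 / n) * cmod (\<Sum>j<n. \<Sum>l<n. \<Sum>k=1..N. c k (int j - int l))"
      by (simp add: I_def norm_mult norm_divide)
    also have "\<dots> \<le> 1 / N * (1 / n) * (\<Sum>j<n. \<Sum>l<n. N * f (int j - int l))"
      by (intro mult_left_mono sum_norm_le) (simp_all only: cf order_refl, simp)
    also have "\<dots> = 1 / n * (\<Sum>j<n. \<Sum>l<n. f (int j - int l))"
      using N by (simp flip: sum_distrib_left)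
    also have "\<dots> \<le> 1 / n * (\<Sum>j<n. R)"
      by (intro mult_left_mono sum_mono inner) auto
    also have "\<dots> = R" using n by simp
    finally have "cmod I \<le> R" .
    then have "\<bar>Re I\<bar> \<le> R" using abs_Re_le_cmod[of I] by linarith
    then show ?thesis using has_integral_Re[OF int] by auto
  qed
  have desc1: "frac (y - t) \<ge> frac y - t" if "t \<ge> 0" for y t :: real
  proof -
    have "\<lfloor>y - t\<rfloor> \<le> \<lfloor>y\<rfloor>" using that by (intro floor_mono) auto
    then show ?thesis by (simp add: frac_def)
  qed
  have desc: "G (v + t) \<ge> G v - t" if "t \<ge> 0" for v t
  proof -
    have "(\<Sum>k=1..N. (frac (x k - v) - 1/2) - t) \<le> (\<Sum>k=1..N. frac (x k - (v + t)) - 1/2)"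
      by (intro sum_mono) (use desc1[OF that, of "x _ - v"] in \<open>simp add: diff_diff_eq\<close>)
    then have "(\<Sum>k=1..N. frac (x k - v) - 1/2) - real N * t \<le> (\<Sum>k=1..N. frac (x k - (v + t)) - 1/2)"
      by (subst (asm) sum_subtractf) simp
    then have "((\<Sum>k=1..N. frac (x k - v) - 1/2) - real N * t) / N \<le> G (v + t)"
      unfolding G_def by (rule divide_right_mono) simp
    then show ?thesis using N by (simp add: G_def diff_divide_distrib)
  qed
  have bounded: "\<bar>G v\<bar> \<le> 1/2" for v
  proof -
    have "\<bar>\<Sum>k=1..N. frac (x k - v) - 1/2\<bar> \<le> (\<Sum>k=1..N. 1/2)"
    proof (intro order_trans[OF sum_abs] sum_mono)
      fix k show "\<bar>frac (x k - v) - 1/2\<bar> \<le> 1/2"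
        using frac_ge_0[of "x k - v"] frac_lt_1[of "x k - v"] unfolding abs_le_iff by linarith
    qed
    then have "\<bar>\<Sum>k=1..N. frac (x k - v) - 1/2\<bar> / N \<le> (\<Sum>k=1..N. 1/2) / N"
      by (rule divide_right_mono) simp
    then show ?thesis using N by (simp add: G_def)
  qed
  define B where "B = (SUP v. \<bar>G v\<bar>)"
  have bdd: "bdd_above (range (\<lambda>v. \<bar>G v\<bar>))" using bounded by (intro bdd_aboveI[of _ "1/2"]) auto
  have GB: "\<bar>G v\<bar> \<le> B" for v unfolding B_def by (rule cSUP_upper[OF _ bdd]) simp
  have up: "G v \<le> 4 * pi / n + B / 2 + R" for v
  proof (rule fejer_one_sided_bound[OF n, of G])
    show "\<exists>I. ((\<lambda>t. G (x + t) * fejer_kernel n t) has_integral I) {- 1 / 2..1 / 2} \<and> I \<le> R" for x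
      using conv[of 1 x] by auto
  qed (use desc GB in auto)
  have fejer_even: "fejer_kernel n (- t) = fejer_kernel n t" for t
  proof -
    have "(\<Sum>j<n. cis (2 * pi * real j * (- t))) = cnj (\<Sum>j<n. cis (2 * pi * real j * t))"
      by (simp add: cis_cnj)
    then show ?thesis unfolding fejer_kernel_def by (simp only: complex_mod_cnj)
  qed
  \<comment> \<open>Negating the value turns upward jumps into downward ones, and negating the
    argument turns them back, so the reflection again falls at rate at most 1.\<close>
  have down: "- G (- v) \<le> 4 * pi / n + B / 2 + R" for v
  proof (rule fejer_one_sided_bound[OF n, of "\<lambda>v. - G (- v)"])
    show "- G (- w) - t \<le> - G (- (w + t))" if "0 \<le> t" for w t
      using desc[OF that, of "- (w + t)"] by simp
    show "\<exists>I. ((\<lambda>t. - G (- (w + t)) * fejer_kernel n t) has_integral I) {- 1 / 2..1 / 2} \<and> I \<le> R" for w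
    proof -
      obtain I where I: "((\<lambda>t. G ((-1) * w + t) * fejer_kernel n t) has_integral I) {-1/2..1/2}" "\<bar>I\<bar> \<le> R"
        using conv[of "-1" w] by auto
      have "((\<lambda>t. G ((-1) * w + - t) * fejer_kernel n (- t)) has_integral I) {- (1/2)..- (-1/2)}"
        using I(1) by (subst has_integral_reflect_real)
      from has_integral_neg[OF this] have "((\<lambda>t. - G (- (w + t)) * fejer_kernel n t) has_integral - I) {-1/2..1/2}"
        by (simp add: fejer_even)
      then show ?thesis using I(2) by (intro exI[of _ "- I"]) auto
    qed
  qed (use GB in auto)
  have "\<bar>G v\<bar> \<le> 4 * pi / n + B / 2 + R" for v
    using up[of v] down[of "- v"] by (auto simp: abs_le_iff)
  \<comment> \<open>\<open>B\<close> is finite by \<open>bounded\<close>, so its half on the right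
    can be moved to the left.\<close>
  then have "B \<le> 4 * pi / n + B / 2 + R"
    unfolding B_def by (intro cSUP_least) auto
  then show ?thesis using GB[of u] by simp
qed

text \<open>The centred indicator of [a, b) is the difference of the sawtooths shifted by b and by
  a. The sawtooth bound is uniform in the shift, so it is used twice.\<close>

theorem erdos_turan:
  fixes x :: "nat \<Rightarrow> real" and N n :: nat
  assumes N: "N > 0" and n: "n > 0"
  shows "discrepancy N x \<le> 16 * pi / n +
     4 * ((\<Sum>h=1..<n. cmod (\<Sum>k=1..N. cis (2 * pi * real h * x k)) / real h) / (pi * real N))"
    (is "_ \<le> ?B")
proof -
  define G where "G = (\<lambda>u. (\<Sum>k=1..N. frac (frac (x k) - u) - 1/2) / real N)"
  have cis_frac: "cis (2 * pi * real h * frac y) = cis (2 * pi * real h * y)" for h y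
    using cis_int_periodic[of "int h" "frac y" "\<lfloor>y\<rfloor>"] by (simp add: frac_def)
  have G: "2 * \<bar>G u\<bar> \<le> ?B" for u
    using erdos_turan_sawtooth[OF N n, of "\<lambda>k. frac (x k)" u] by (simp add: G_def cis_frac)
  have "\<bar>1 / real N * (\<Sum>k = 1..N. indicator {a..<b} (frac (x k))) - (b - a)\<bar> \<le> ?B"
    if ab: "0 \<le> a" "a < b" "b \<le> 1" for a b
  proof -
    have frac: "frac (frac y - u) = frac y - u + (if frac y < u then 1 else 0)"
      if "0 \<le> u" "u \<le> 1" for u y :: real
      using that frac_ge_0[of y] frac_lt_1[of y] by (auto simp: frac_unique_iff simp del: frac_ge_0)
    have ind: "indicator {a..<b} (frac y) - (b - a) = frac (frac y - b) - frac (frac y - a)" for y :: real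
      using ab by (auto simp: frac indicator_def)
    have "1 / real N * (\<Sum>k = 1..N. indicator {a..<b} (frac (x k))) - (b - a) =
       (\<Sum>k = 1..N. indicator {a..<b} (frac (x k)) - (b - a)) / N"
      using N by (simp add: sum_subtractf diff_divide_distrib)
    also have "\<dots> = G b - G a"
      by (simp add: G_def ind sum_subtractf diff_divide_distrib)
    finally show ?thesis using G[of a] G[of b] by linarith
  qed
  moreover have "(0, 1) \<in> {(a, b). 0 \<le> a \<and> a < b \<and> b \<le> (1::real)}" by simp
  ultimately show ?thesis unfolding discrepancy_def
    by (intro cSUP_least) (blast, clarify)
qed

section \<open>Sums of distances to the nearest integer\<close>

lemma dist_int_le: "dist_int t \<le> \<bar>t - of_int k\<bar>"
  unfolding dist_int_def using infdist_le[of "of_int k" \<int> t] by (simp add: dist_real_def)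

lemma dist_int_geI:
  assumes "\<And>k::int. r \<le> \<bar>t - of_int k\<bar>"
  shows "r \<le> dist_int t"
proof -
  obtain y where y: "y \<in> \<int>" "infdist t \<int> = dist t y"
    by (rule infdist_attains_inf[of "\<int>::real set" t]) (use Ints_0 in auto)
  then obtain k where "y = of_int k" by (auto elim: Ints_cases)
  then show ?thesis using assms[of k] y by (simp add: dist_int_def dist_real_def)
qed

text \<open>Integral comparison in discrete form: weighted AM-GM for y = m/(m+1) gives y^p \<le> 1 -
  p/(m+1), that is, (m+1)^p - m^p is at least p (m+1)^(p-1).\<close>

lemma sum_powr_le:
  fixes p :: real
  assumes "0 < p" "p \<le> 1"
  shows "(\<Sum>r=1..m. real r powr (p - 1)) \<le> real m powr p / p"
proof (induction m)
  case (Suc m)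
  show ?case
  proof (cases "m = 0")
    case True
    then show ?thesis using assms by simp
  next
    case False
    define y where "y = real m / real (Suc m)"
    have y: "0 < y" using False by (simp add: y_def)
    have "y powr p * 1 powr (1 - p) \<le> p * y + (1 - p) * 1"
      using assms y by (intro Youngs_inequality_0) auto
    then have "y powr p \<le> 1 - p / real (Suc m)"
      by (simp add: y_def field_simps)
    then have "real (Suc m) powr p * y powr p \<le> real (Suc m) powr p * (1 - p / real (Suc m))"
      by (intro mult_left_mono) auto
    also have "real (Suc m) powr p * y powr p = real m powr p"
      using y by (simp add: powr_mult[symmetric] y_def del: of_nat_Suc)
    also have "real (Suc m) powr p * (1 - p / real (Suc m)) = real (Suc m) powr p - p * real (Suc m) powr (p - 1)"
      by (simp add: powr_diff algebra_simps del: of_nat_Suc)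
    finally have "(real m powr p + p * real (Suc m) powr (p - 1)) / p \<le> real (Suc m) powr p / p"
      using assms by (intro divide_right_mono) (auto simp del: of_nat_Suc)
    then have "real m powr p / p + real (Suc m) powr (p - 1) \<le> real (Suc m) powr p / p"
      using assms by (simp add: add_divide_distrib del: of_nat_Suc)
    then show ?thesis using Suc by simp
  qed
qed simp

text \<open>For p > 1 the terms increase and m copies of the last one suffice. The constant covers
  both ranges of p.\<close>

lemma sum_powr_le_powr:
  fixes p :: real
  assumes "0 < p"
  shows "(\<Sum>r=1..m. real r powr (p - 1)) \<le> (1 + 1 / p) * real m powr p"
proof (cases "p \<le> 1")
  case True
  have "(\<Sum>r=1..m. real r powr (p - 1)) \<le> real m powr p / p"
    by (rule sum_powr_le) (use True assms in auto)
  also have "\<dots> \<le> (1 + 1 / p) * real m powr p"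
    by (simp add: distrib_right)
  finally show ?thesis .
next
  case False
  have "(\<Sum>r=1..m. real r powr (p - 1)) \<le> (\<Sum>r=1..m. real m powr (p - 1))"
    using False by (intro sum_mono powr_mono2) auto
  also have "\<dots> = real m powr p"
    by (cases "m = 0") (auto simp: powr_diff)
  also have "\<dots> \<le> (1 + 1 / p) * real m powr p"
    using assms by (simp add: distrib_right)
  finally show ?thesis .
qed

lemma sum_inverse_le_ln:
  assumes "m \<ge> 1" shows "(\<Sum>r=1..m. real r powr (- 1)) \<le> 1 + ln (real m)"
  using assms
proof (induction m rule: dec_induct)
  case (step m)
  have m: "real m > 0" using step.hyps by simp
  have "ln (real m / real (Suc m)) \<le> real m / real (Suc m) - 1"
    using m by (intro ln_le_minus_one) auto
  also have "\<dots> = - (1 / real (Suc m))" by (simp add: field_simps)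
  finally have "1 / real (Suc m) \<le> ln (real (Suc m)) - ln (real m)"
    using m by (simp add: ln_div del: of_nat_Suc)
  then show ?case using step.IH by (simp add: powr_minus_divide del: of_nat_Suc)
qed simp

section \<open>Sums of negative powers of distances along multiples\<close>

text \<open>By coprimality, h \<mapsto> h a mod m is injective on a block of m consecutive integers,
  and non-multiples of m go to nonzero residues. Each block thus costs at most one full sum of g,
  and \<open>Q div m + 1\<close> blocks cover 1..Q.\<close>

lemma sum_residues_le:
  fixes m :: nat and a :: int and g :: "nat \<Rightarrow> real"
  assumes m: "m > 0" and a: "coprime a (int m)" and g: "\<And>r. g r \<ge> 0"
  shows "(\<Sum>h=1..Q. if m dvd h then 0 else g (nat (int h * a mod int m)))
           \<le> (real Q / real m + 1) * (\<Sum>r=1..<m. g r)"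
proof -
  define r where "r = (\<lambda>h::nat. nat (int h * a mod int m))"
  define f where "f = (\<lambda>h. if m dvd h then 0 else g (r h))"
  have f0: "f h \<ge> 0" for h using g by (simp add: f_def)
  have r_int: "int (r h) = int h * a mod int m" for h
    using m by (simp add: r_def)
  have dvd: "m dvd h" if "r h = 0" for h
  proof -
    have "int m dvd int h * a" using that r_int[of h] by auto
    then show ?thesis using a by (simp add: coprime_dvd_mult_left_iff coprime_commute)
  qed
  have block: "(\<Sum>h\<in>{i * m..<i * m + m}. f h) \<le> (\<Sum>r=1..<m. g r)" for i
  proof -
    let ?A = "{h \<in> {i * m..<i * m + m}. \<not> m dvd h}"
    have "(\<Sum>h\<in>{i * m..<i * m + m}. f h) = (\<Sum>h\<in>?A. g (r h))"
      by (rule sum.mono_neutral_cong_right) (auto simp: f_def)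
    also have "\<dots> = (\<Sum>s\<in>r ` ?A. g s)"
    proof (rule sum.reindex_cong[symmetric, where l=r])
      show "inj_on r ?A"
      proof (rule inj_onI)
        fix h k assume hk: "h \<in> ?A" "k \<in> ?A" "r h = r k"
        then have "int h * a mod int m = int k * a mod int m" by (metis r_int)
        then have "int m dvd (int h - int k) * a"
          by (metis left_diff_distrib mod_eq_dvd_iff)
        then have "int m dvd int h - int k"
          using a by (simp add: coprime_dvd_mult_left_iff coprime_commute)
        moreover have "\<bar>int h - int k\<bar> < int m" using hk by auto
        ultimately show "h = k" using dvd_imp_le_int[of "int h - int k" "int m"] by fastforce
      qed
    qed auto
    also have "\<dots> \<le> (\<Sum>r=1..<m. g r)"
    proof (rule sum_mono2)
      show "r ` ?A \<subseteq> {1..<m}"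
      proof safe
        fix h assume h: "h \<in> {i * m..<i * m + m}" "\<not> m dvd h"
        have "r h \<noteq> 0" using dvd h by blast
        moreover have "r h < m" using r_int[of h] m by (metis of_nat_less_iff of_nat_0_less_iff pos_mod_bound)
        ultimately show "r h \<in> {1..<m}" by auto
      qed
    qed (use g in auto)
    finally show ?thesis .
  qed
  have "(\<Sum>h=1..Q. f h) \<le> (\<Sum>h<(Q div m + 1) * m. f h)"
  proof (rule sum_mono2)
    have "Q < (Q div m + 1) * m" using m
      by (metis add.commute add_mult_distrib div_mult_mod_eq mod_less_divisor mult_1 nat_add_left_cancel_less)
    then show "{1..Q} \<subseteq> {..<(Q div m + 1) * m}" by auto
  qed (use f0 in auto)
  also have "\<dots> = (\<Sum>i<Q div m + 1. \<Sum>h\<in>{i * m..<i * m + m}. f h)"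
    by (rule sum.nat_group[symmetric])
  also have "\<dots> \<le> (\<Sum>i<Q div m + 1. \<Sum>r=1..<m. g r)"
    by (intro sum_mono block)
  also have "\<dots> = (real (Q div m) + 1) * (\<Sum>r=1..<m. g r)"
    by simp
  also have "\<dots> \<le> (real Q / real m + 1) * (\<Sum>r=1..<m. g r)"
    using g by (intro mult_right_mono sum_nonneg) (auto simp: of_nat_div_le_of_nat)
  finally show ?thesis unfolding f_def r_def .
qed

text \<open>Let a/m be a Dirichlet approximation of \<alpha>. If m does not divide h, then h
  \<alpha> is so close to h a / m that the residue of h a modulo m decides its distance to the
  integers; these h are summed over residues. Multiples of m are handled by the Diophantine
  condition for m itself. The bound \<Lambda> stays a parameter, since it is a constant for b < 1
  and a logarithm for b = 1.\<close>

lemma sum_dist_int_powr_le: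
  fixes \<alpha> \<gamma> C b \<Lambda> :: real and Q :: nat
  assumes C: "C > 0" and b: "b > 0" and Q: "Q \<ge> 1"
    and dioph: "\<And>q::nat. q \<ge> 1 \<Longrightarrow> dist_int (real q * \<alpha>) \<ge> C * real q powr (- \<gamma>)"
    and L: "\<And>m. 1 \<le> m \<Longrightarrow> m \<le> 4 * Q \<Longrightarrow> real m powr (b - 1) * (\<Sum>r=1..m. real r powr (- b)) \<le> \<Lambda>"
  shows "(\<Sum>h=1..Q. dist_int (real h * \<alpha>) powr (- b)) \<le>
           10 * 2 powr b * \<Lambda> * real Q + C powr (- b) * real Q powr (max 1 (\<gamma> * b))"
proof -
  \<comment> \<open>The quality 4Q gives |h \<eta>| \<le> 1/4 for all h \<le> Q, which cannot cancel
    a nonzero integer numerator.\<close>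
  obtain a k :: int where ak: "coprime a k" "0 < k" "k \<le> int (4 * Q)"
      "\<bar>of_int k * \<alpha> - of_int a\<bar> < 1 / real (4 * Q)"
    using Dirichlet_approx_coprime[of "4 * Q" \<alpha>] Q by (metis mult_pos_pos zero_less_numeral One_nat_def Suc_le_eq)
  define m where "m = nat k"
  have m: "1 \<le> m" "m \<le> 4 * Q" "k = int m" using ak by (auto simp: m_def)
  define \<eta> where "\<eta> = real m * \<alpha> - of_int a"
  have \<eta>: "\<bar>\<eta>\<bar> < 1 / (4 * real Q)" using ak(4) m by (simp add: \<eta>_def)
  have \<alpha>: "\<alpha> = (of_int a + \<eta>) / real m" using m by (simp add: \<eta>_def)
  \<comment> \<open>The distance of the residue r to the multiples of m is the smaller of r and m -
    r. Adding both powers majorises the power of the minimum and splits into two equal sums.\<close>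
  define g where "g = (\<lambda>r::nat. real r powr (- b) + real (m - r) powr (- b))"
  define r where "r = (\<lambda>h::nat. nat (int h * a mod int m))"
  have nonmult: "dist_int (real h * \<alpha>) powr (- b) \<le> 2 powr b * real m powr b * g (r h)"
    if h: "h \<in> {1..Q}" "\<not> m dvd h" for h
  proof -
    have r_int: "int (r h) = int h * a mod int m" using m by (simp add: r_def)
    have "r h \<noteq> 0"
    proof
      assume "r h = 0"
      then have "int m dvd int h * a" using r_int by auto
      then show False using ak(1) h m by (simp add: coprime_dvd_mult_left_iff coprime_commute)
    qed
    moreover have "r h < m" using r_int m
      by (metis of_nat_less_iff of_nat_0_less_iff pos_mod_bound Suc_le_eq One_nat_def)
    ultimately have r: "0 < r h" "r h < m" by auto
    define \<mu> where "\<mu> = min (r h) (m - r h)"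
    have \<mu>: "\<mu> \<ge> 1" using r by (auto simp: \<mu>_def)
    have "real \<mu> / (2 * real m) \<le> dist_int (real h * \<alpha>)"
    proof (rule dist_int_geI)
      fix j :: int
      \<comment> \<open>The numerator of h a / m - j. It is congruent to \<open>r h\<close> modulo m
        with 0 < \<open>r h\<close> < m, hence |z| \<ge> \<open>\<mu>\<close> \<ge> 1, and the
        perturbation of at most 1/4 leaves at least \<open>\<mu>\<close> / 2.\<close>
      define z where "z = int h * a - j * int m"
      have "z = int h * a + (- j) * int m" by (simp add: z_def)
      then have "z mod int m = int (r h)" by (simp only: mod_mult_self1 r_int)
      then obtain q where q: "z = q * int m + int (r h)"
        by (metis div_mult_mod_eq)
      have "\<bar>z\<bar> \<ge> int \<mu>"
      proof (cases "q \<ge> 0")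
        case True
        then have "q * int m \<ge> 0" by simp
        then have "z \<ge> int (r h)" unfolding q by linarith
        then show ?thesis by (simp add: \<mu>_def)
      next
        case False
        then have "q * int m \<le> (-1) * int m" by (intro mult_right_mono) auto
        then have "z \<le> - int (m - r h)" using q r by (simp add: of_nat_diff)
        then show ?thesis by (simp add: \<mu>_def)
      qed
      then have z: "real \<mu> \<le> \<bar>of_int z\<bar>" by (metis of_int_abs of_int_le_iff of_int_of_nat_eq)
      have eq: "real h * \<alpha> - of_int j = (of_int z + real h * \<eta>) / real m"
        using m by (simp add: \<alpha> z_def field_simps)
      have "\<bar>real h * \<eta>\<bar> \<le> real Q * (1 / (4 * real Q))"
        unfolding abs_mult using h \<eta> by (intro mult_mono) auto
      then have "\<bar>real h * \<eta>\<bar> \<le> 1/4" using Q by simp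
      then have "real \<mu> / 2 \<le> \<bar>of_int z + real h * \<eta>\<bar>"
        using z \<mu> by linarith
      then have "real \<mu> / 2 / real m \<le> \<bar>of_int z + real h * \<eta>\<bar> / real m"
        by (rule divide_right_mono) simp
      then show "real \<mu> / (2 * real m) \<le> \<bar>real h * \<alpha> - of_int j\<bar>"
        unfolding eq by (simp add: abs_divide)
    qed
    then have "dist_int (real h * \<alpha>) powr (- b) \<le> (real \<mu> / (2 * real m)) powr (- b)"
      using \<mu> m b by (intro powr_mono2') auto
    also have "\<dots> = 2 powr b * real m powr b * real \<mu> powr (- b)"
      using \<mu> m by (simp add: powr_divide powr_mult powr_minus field_simps)
    also have "real \<mu> powr (- b) \<le> g (r h)"
      by (auto simp: \<mu>_def min_def g_def)
    finally show ?thesis by (simp add: mult_left_mono)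
  qed
  have mult: "dist_int (real h * \<alpha>) powr (- b) \<le> C powr (- b) * real m powr (\<gamma> * b)"
    if h: "h \<in> {1..Q}" "m dvd h" for h
  proof -
    obtain j where j: "h = m * j" using h by blast
    have j1: "j \<ge> 1" using h j by (cases j) auto
    \<comment> \<open>For h = m j the number h \<alpha> lies j \<eta> away from the integer j a. Any
      other integer is at distance at least 1 - 1/4, which exceeds |\<eta>|.\<close>
    have "\<bar>\<eta>\<bar> \<le> dist_int (real h * \<alpha>)"
    proof (rule dist_int_geI)
      fix i :: int
      have eq: "real h * \<alpha> - of_int i = of_int (int j * a - i) + real j * \<eta>"
        using m by (simp add: \<alpha> j field_simps)
      have Q4: "1 / (4 * real Q) \<le> 1/4" using Q by (simp add: field_simps)
      show "\<bar>\<eta>\<bar> \<le> \<bar>real h * \<alpha> - of_int i\<bar>"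
      proof (cases "int j * a = i")
        case True
        have "1 * \<bar>\<eta>\<bar> \<le> real j * \<bar>\<eta>\<bar>" using j1 by (intro mult_right_mono) auto
        then show ?thesis unfolding eq using True by (simp add: abs_mult)
      next
        case False
        then have "\<bar>int j * a - i\<bar> \<ge> 1" by linarith
        then have 1: "\<bar>real_of_int (int j * a - i)\<bar> \<ge> 1" by (metis of_int_1 of_int_abs of_int_le_iff)
        have "j \<le> Q" using h j m by (metis atLeastAtMost_iff dual_order.trans mult_le_mono1 mult_1)
        then have "\<bar>real j * \<eta>\<bar> \<le> real Q * (1 / (4 * real Q))"
          unfolding abs_mult using \<eta> by (intro mult_mono) auto
        then have "\<bar>real j * \<eta>\<bar> \<le> 1/4" using Q by simp
        then show ?thesis unfolding eq using 1 \<eta> Q4 by linarith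
      qed
    qed
    moreover have "C * real m powr (- \<gamma>) \<le> \<bar>\<eta>\<bar>"
      using dioph[of m] dist_int_le[of "real m * \<alpha>" a] m by (simp add: \<eta>_def)
    ultimately have "dist_int (real h * \<alpha>) powr (- b) \<le> (C * real m powr (- \<gamma>)) powr (- b)"
      using C m b by (intro powr_mono2') auto
    also have "\<dots> = C powr (- b) * real m powr (\<gamma> * b)"
      using C m by (simp add: powr_mult powr_powr)
    finally show ?thesis .
  qed
  have "(\<Sum>h=1..Q. dist_int (real h * \<alpha>) powr (- b)) \<le>
      (\<Sum>h=1..Q. 2 powr b * real m powr b * (if m dvd h then 0 else g (r h)) +
         (if m dvd h then C powr (- b) * real m powr (\<gamma> * b) else 0))"
    using nonmult mult by (intro sum_mono) auto
  also have "\<dots> = 2 powr b * real m powr b * (\<Sum>h=1..Q. if m dvd h then 0 else g (r h)) +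
      (\<Sum>h=1..Q. if m dvd h then C powr (- b) * real m powr (\<gamma> * b) else 0)"
    by (simp add: sum.distrib sum_distrib_left)
  also have "(\<Sum>h=1..Q. if m dvd h then C powr (- b) * real m powr (\<gamma> * b) else 0)
      \<le> C powr (- b) * real Q powr (max 1 (\<gamma> * b))"
  proof -
    have "(\<Sum>h=1..Q. if m dvd h then C powr (- b) * real m powr (\<gamma> * b) else 0) =
        real (card {h \<in> {1..Q}. m dvd h}) * (C powr (- b) * real m powr (\<gamma> * b))"
      by (simp add: sum.If_cases Int_def)
    also have "\<dots> \<le> C powr (- b) * real Q powr (max 1 (\<gamma> * b))"
    \<comment> \<open>At most Q/m multiples occur, each costing m^(\<gamma> b), and Q m^(\<gamma> b
      - 1) is largest at m = 1 or m = Q according to the sign of the exponent. For m > Q there are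
      no multiples in range.\<close>
    proof (cases "m \<le> Q")
      case True
      have "{h \<in> {1..Q}. m dvd h} \<subseteq> (\<lambda>j. m * j) ` {1..Q div m}"
        using m by (auto simp: image_iff less_eq_div_iff_mult_less_eq mult.commute elim!: dvdE intro!: bexI)
      then have "card {h \<in> {1..Q}. m dvd h} \<le> card {1..Q div m}"
        by (rule surj_card_le[rotated]) simp
      then have "real (card {h \<in> {1..Q}. m dvd h}) \<le> real (Q div m)" by simp
      also have "\<dots> \<le> real Q / real m" by (rule of_nat_div_le_of_nat)
      finally have "real (card {h \<in> {1..Q}. m dvd h}) \<le> real Q / real m" .
      then have "real (card {h \<in> {1..Q}. m dvd h}) * (C powr (- b) * real m powr (\<gamma> * b))
          \<le> real Q / real m * (C powr (- b) * real m powr (\<gamma> * b))"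
        by (intro mult_right_mono) auto
      also have "\<dots> = C powr (- b) * (real Q * real m powr (\<gamma> * b - 1))"
        using m by (simp add: powr_diff)
      also have "real m powr (\<gamma> * b - 1) \<le> real Q powr (max 1 (\<gamma> * b) - 1)"
      proof -
        have "real m powr (\<gamma> * b - 1) \<le> real m powr (max 1 (\<gamma> * b) - 1)"
          using m by (intro powr_mono) auto
        also have "\<dots> \<le> real Q powr (max 1 (\<gamma> * b) - 1)"
          using True by (intro powr_mono2) auto
        finally show ?thesis .
      qed
      also have "real Q * real Q powr (max 1 (\<gamma> * b) - 1) = real Q powr (max 1 (\<gamma> * b))"
        using Q by (simp add: powr_diff)
      finally show ?thesis by (simp add: mult_left_mono)
    next
      case False
      then have empty: "{h \<in> {1..Q}. m dvd h} = {}" by (auto dest: dvd_imp_le)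
      show ?thesis unfolding empty by simp
    qed
    finally show ?thesis .
  qed
  also have "2 powr b * real m powr b * (\<Sum>h=1..Q. if m dvd h then 0 else g (r h)) \<le> 10 * 2 powr b * \<Lambda> * real Q"
  proof -
    have gsum: "(\<Sum>r=1..<m. g r) \<le> 2 * (\<Sum>r=1..m. real r powr (- b))"
    proof -
      have "(\<Sum>r=1..<m. real (m - r) powr (- b)) = (\<Sum>r=1..<m. real r powr (- b))"
        by (rule sum.reindex_bij_witness[where i="\<lambda>r. m - r" and j="\<lambda>r. m - r"]) auto
      then have "(\<Sum>r=1..<m. g r) = 2 * (\<Sum>r=1..<m. real r powr (- b))"
        by (simp add: g_def sum.distrib)
      also have "(\<Sum>r=1..<m. real r powr (- b)) \<le> (\<Sum>r=1..m. real r powr (- b))"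
        by (rule sum_mono2) auto
      finally show ?thesis by simp
    qed
    have "(\<Sum>h=1..Q. if m dvd h then 0 else g (r h)) \<le> (real Q / real m + 1) * (\<Sum>r=1..<m. g r)"
      unfolding r_def using m ak(1) by (intro sum_residues_le) (auto simp: g_def)
    also have "\<dots> \<le> (real Q / real m + 1) * (2 * (\<Sum>r=1..m. real r powr (- b)))"
      by (intro mult_left_mono gsum) auto
    finally have "2 powr b * real m powr b * (\<Sum>h=1..Q. if m dvd h then 0 else g (r h)) \<le>
       2 powr b * real m powr b * ((real Q / real m + 1) * (2 * (\<Sum>r=1..m. real r powr (- b))))"
      by (intro mult_left_mono) auto
    also have "\<dots> = 2 * 2 powr b * (real Q + real m) * (real m powr (b - 1) * (\<Sum>r=1..m. real r powr (- b)))"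
      using m by (simp add: powr_diff field_simps)
    \<comment> \<open>Here 5Q bounds Q + m, since m \<le> 4Q.\<close>
    also have "\<dots> \<le> 2 * 2 powr b * (5 * real Q) * \<Lambda>"
      using m L[of m] by (intro mult_mono mult_nonneg_nonneg sum_nonneg) auto
    finally show ?thesis by (simp add: mult_ac)
  qed
  finally show ?thesis by simp
qed

section \<open>Partial summation against 1/h\<close>

lemma abel_sum_inverse:
  fixes u :: "nat \<Rightarrow> real"
  assumes "H \<ge> 1"
  shows "(\<Sum>h=1..H. u h / real h) =
     (\<Sum>h=1..H. u h) / real H + (\<Sum>q=1..<H. (\<Sum>h=1..q. u h) / (real q * (real q + 1)))"
  using assms
proof (induction H rule: dec_induct)
  case (step H)
  define U where "U = (\<Sum>h=1..H. u h)"
  have "(\<Sum>h=1..Suc H. u h / real h) = (\<Sum>h=1..H. u h / real h) + u (Suc H) / real (Suc H)"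
    by simp
  also have "\<dots> = U / real H + (\<Sum>q=1..<H. (\<Sum>h=1..q. u h) / (real q * (real q + 1))) + u (Suc H) / real (Suc H)"
    unfolding U_def using step.IH by simp
  also have "U / real H = U / real (Suc H) + U / (real H * (real H + 1))"
    using step.hyps by (simp add: divide_simps add_nonneg_eq_0_iff) (simp add: algebra_simps)?
  finally show ?case
    using step.hyps by (simp add: U_def add_divide_distrib)
qed simp

text \<open>The power sum on the right is left unevaluated so that p = 0, where it is a logarithm,
  and p > 0, where it is again a power, share one proof.\<close>

lemma sum_inverse_weighted_le:
  fixes u :: "nat \<Rightarrow> real"
  assumes H: "H \<ge> 1" and K: "K \<ge> 0"
    and U: "\<And>q. 1 \<le> q \<Longrightarrow> q \<le> H \<Longrightarrow> (\<Sum>h=1..q. u h) \<le> K * real q powr (p + 1)"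
  shows "(\<Sum>h=1..H. u h / real h) \<le> K * (real H powr p + (\<Sum>q=1..H. real q powr (p - 1)))"
proof -
  have "(\<Sum>h=1..H. u h) / real H \<le> K * real H powr (p + 1) / real H"
    using U[of H] H by (intro divide_right_mono) auto
  also have "\<dots> = K * real H powr p" using H by (simp add: powr_add)
  finally have 1: "(\<Sum>h=1..H. u h) / real H \<le> K * real H powr p" .
  have "(\<Sum>q=1..<H. (\<Sum>h=1..q. u h) / (real q * (real q + 1))) \<le> (\<Sum>q=1..<H. K * real q powr (p - 1))"
  proof (rule sum_mono)
    fix q assume q: "q \<in> {1..<H}"
    have "(\<Sum>h=1..q. u h) / (real q * (real q + 1)) \<le> (K * real q powr (p + 1)) / (real q * (real q + 1))"
      using U[of q] q by (intro divide_right_mono) auto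
    also have "\<dots> \<le> (K * real q powr (p + 1)) / (real q * real q)"
      using q K by (intro divide_left_mono mult_left_mono mult_pos_pos mult_nonneg_nonneg) auto
    also have "\<dots> = K * real q powr (p - 1)"
      using q by (simp add: powr_add powr_diff)
    finally show "(\<Sum>h=1..q. u h) / (real q * (real q + 1)) \<le> K * real q powr (p - 1)" .
  qed
  also have "\<dots> \<le> (\<Sum>q=1..H. K * real q powr (p - 1))"
    using K by (intro sum_mono2) auto
  finally show ?thesis
    unfolding abel_sum_inverse[OF H] using 1 by (simp add: distrib_left sum_distrib_left)
qed

text \<open>For b < 1 the parameter \<Lambda> is 1/(1 - b). For b = 1 it is a logarithm, absorbed by
  Q^(\<gamma> - 1) because \<gamma> > 1. The critical case b = \<gamma> = 1, where the logarithm
  stays, is treated in \<open>weighted_dist_int_sum_log2\<close>.\<close>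

lemma sum_dist_int_powr_bigo:
  fixes \<alpha> \<gamma> C b :: real
  assumes C: "C > 0" and b: "0 < b" "b \<le> 1" "b < 1 \<or> \<gamma> * b > 1"
    and dioph: "\<And>q::nat. q \<ge> 1 \<Longrightarrow> dist_int (real q * \<alpha>) \<ge> C * real q powr (- \<gamma>)"
  obtains K where "K > 0"
    "\<And>Q. Q \<ge> 1 \<Longrightarrow> (\<Sum>h=1..Q. dist_int (real h * \<alpha>) powr (- b)) \<le> K * real Q powr (max 1 (\<gamma> * b))"
proof (cases "b < 1")
  case True
  define K where "K = 10 * 2 powr b * (1 / (1 - b)) + C powr (- b)"
  show ?thesis
  proof (rule that)
    show "K > 0" unfolding K_def using True C b by (intro add_pos_pos mult_pos_pos) auto
    fix Q :: nat assume Q: "Q \<ge> 1"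
    have "(\<Sum>h=1..Q. dist_int (real h * \<alpha>) powr (- b)) \<le>
        10 * 2 powr b * (1 / (1 - b)) * real Q + C powr (- b) * real Q powr (max 1 (\<gamma> * b))"
    proof (rule sum_dist_int_powr_le[OF C b(1) Q dioph])
      fix m :: nat assume m: "1 \<le> m"
      have "(\<Sum>r=1..m. real r powr (- b)) \<le> real m powr (1 - b) / (1 - b)"
        using sum_powr_le[of "1 - b" m] True b by simp
      then have "real m powr (b - 1) * (\<Sum>r=1..m. real r powr (- b)) \<le>
          real m powr (b - 1) * (real m powr (1 - b) / (1 - b))"
        by (rule mult_left_mono) simp
      also have "\<dots> = 1 / (1 - b)" using m by (simp flip: powr_add)
      finally show "real m powr (b - 1) * (\<Sum>r=1..m. real r powr (- b)) \<le> 1 / (1 - b)" .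
    qed auto
    also have "10 * 2 powr b * (1 / (1 - b)) * real Q \<le> 10 * 2 powr b * (1 / (1 - b)) * real Q powr (max 1 (\<gamma> * b))"
      using powr_mono[of 1 "max 1 (\<gamma> * b)" "real Q"] Q True by (intro mult_left_mono) auto
    finally show "(\<Sum>h=1..Q. dist_int (real h * \<alpha>) powr (- b)) \<le> K * real Q powr (max 1 (\<gamma> * b))"
      unfolding K_def by (simp add: distrib_right)
  qed
next
  case False
  then have b1: "b = 1" and \<gamma>: "\<gamma> > 1" using b by auto
  define K where "K = 20 * (3 + 1 / (\<gamma> - 1)) + C powr (- 1)"
  show ?thesis
  proof (rule that)
    show "K > 0" unfolding K_def using C \<gamma> by (intro add_pos_pos mult_pos_pos) auto
    fix Q :: nat assume Q: "Q \<ge> 1"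
    have "(\<Sum>h=1..Q. dist_int (real h * \<alpha>) powr (- b)) \<le>
        10 * 2 powr b * (1 + ln (real (4 * Q))) * real Q + C powr (- b) * real Q powr (max 1 (\<gamma> * b))"
    proof (rule sum_dist_int_powr_le[OF C b(1) Q dioph])
      fix m :: nat assume m: "1 \<le> m" "m \<le> 4 * Q"
      have "ln (real m) \<le> ln (real (4 * Q))" using m by (subst ln_le_cancel_iff) auto
      then have "(\<Sum>r=1..m. real r powr (- b)) \<le> 1 + ln (real (4 * Q))"
        using sum_inverse_le_ln[OF m(1)] unfolding b1 by linarith
      then show "real m powr (b - 1) * (\<Sum>r=1..m. real r powr (- b)) \<le> 1 + ln (real (4 * Q))"
        using m by (simp add: b1)
    qed auto
    \<comment> \<open>The 3 covers 1 + ln 4, as ln 4 \<le> 2; the rest is ln Q \<le> Q^(\<gamma> -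
      1) / (\<gamma> - 1).\<close>
    also have ln4: "1 + ln (real (4 * Q)) \<le> (3 + 1 / (\<gamma> - 1)) * real Q powr (\<gamma> - 1)"
    proof -
      have "ln (real (4 * Q)) = ln 4 + ln (real Q)" using Q by (simp add: ln_mult)
      moreover have "ln 4 = 2 * ln (2::real)" using ln_realpow[of "2::real" 2] by simp
      moreover have "ln (2::real) \<le> 1" using ln_le_minus_one[of "2::real"] by simp
      moreover have "ln (real Q) \<le> real Q powr (\<gamma> - 1) / (\<gamma> - 1)"
        using ln_powr_bound[of "real Q" "\<gamma> - 1"] Q \<gamma> by simp
      moreover have "1 \<le> real Q powr (\<gamma> - 1)" using Q \<gamma> by (intro ge_one_powr_ge_zero) auto
      ultimately show ?thesis by (simp add: distrib_right)
    qed
    finally have "(\<Sum>h=1..Q. dist_int (real h * \<alpha>) powr (- b)) \<le>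
       10 * 2 powr b * ((3 + 1 / (\<gamma> - 1)) * real Q powr (\<gamma> - 1)) * real Q + C powr (- b) * real Q powr (max 1 (\<gamma> * b))"
      by (simp add: mult_left_mono mult_right_mono)
    also have "\<dots> = 20 * (3 + 1 / (\<gamma> - 1)) * (real Q powr (\<gamma> - 1) * real Q) + C powr (- 1) * real Q powr \<gamma>"
      using \<gamma> by (simp add: b1)
    also have "real Q powr (\<gamma> - 1) * real Q = real Q powr \<gamma>" using Q by (simp add: powr_diff)
    finally show "(\<Sum>h=1..Q. dist_int (real h * \<alpha>) powr (- b)) \<le> K * real Q powr (max 1 (\<gamma> * b))"
      unfolding K_def using \<gamma> by (simp add: b1 distrib_right)
  qed
qed

text \<open>The unweighted partial sums grow linearly in this range, so partial summation yields one
  harmonic sum.\<close>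

lemma weighted_dist_int_sum_log:
  fixes \<alpha> \<gamma> C b :: real
  assumes C: "C > 0" and b: "0 < b" "b < 1" "\<gamma> * b \<le> 1"
    and dioph: "\<And>q::nat. q \<ge> 1 \<Longrightarrow> dist_int (real q * \<alpha>) \<ge> C * real q powr (- \<gamma>)"
  obtains K where "K > 0"
    "\<And>H. H \<ge> 1 \<Longrightarrow> (\<Sum>h=1..H. dist_int (real h * \<alpha>) powr (- b) / real h) \<le> K * (1 + ln (real H))"
proof -
  obtain K where K: "K > 0"
    "\<And>Q. Q \<ge> 1 \<Longrightarrow> (\<Sum>h=1..Q. dist_int (real h * \<alpha>) powr (- b)) \<le> K * real Q powr (max 1 (\<gamma> * b))"
    using sum_dist_int_powr_bigo[of C b \<gamma> \<alpha>] assms by (metis less_imp_le)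
  show ?thesis
  proof (rule that)
    show "2 * K > 0" using K by simp
    fix H :: nat assume H: "H \<ge> 1"
    have "(\<Sum>h=1..H. dist_int (real h * \<alpha>) powr (- b) / real h) \<le>
        K * (real H powr 0 + (\<Sum>q=1..H. real q powr (0 - 1)))"
      using K b by (intro sum_inverse_weighted_le[OF H]) (auto simp: max_absorb1)
    also have "\<dots> \<le> K * (1 + (1 + ln (real H)))"
      using sum_inverse_le_ln[OF H] K H by (intro mult_left_mono add_mono) auto
    also have "\<dots> \<le> 2 * K * (1 + ln (real H))"
      using K H by (simp add: algebra_simps)
    finally show "(\<Sum>h=1..H. dist_int (real h * \<alpha>) powr (- b) / real h) \<le> 2 * K * (1 + ln (real H))" .
  qed
qed

text \<open>One logarithm comes from \<Lambda> and a second one from partial summation.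
  \<open>KH\<close> is formed with H rather than q so that it is a single constant for all partial
  sums; the 60 in \<open>K\<close> is 20 times the 3 that bounds 1 + ln 4.\<close>

lemma weighted_dist_int_sum_log2:
  fixes \<alpha> C :: real
  assumes C: "C > 0"
    and dioph: "\<And>q::nat. q \<ge> 1 \<Longrightarrow> dist_int (real q * \<alpha>) \<ge> C * real q powr (- 1)"
  obtains K where "K > 0"
    "\<And>H. H \<ge> 1 \<Longrightarrow> (\<Sum>h=1..H. dist_int (real h * \<alpha>) powr (- 1) / real h) \<le> K * (1 + ln (real H))\<^sup>2"
proof (rule that)
  define K where "K = 60 + C powr (- 1)"
  show "2 * K > 0" using C by (simp add: K_def add_pos_pos)
  fix H :: nat assume H: "H \<ge> 1"
  have lnH: "ln (real H) \<ge> 0" using H by simp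
  define KH where "KH = 20 * (1 + ln (real (4 * H))) + C powr (- 1)"
  have "ln (real (4 * H)) = ln 4 + ln (real H)" using H by (simp add: ln_mult)
  moreover have "ln 4 = 2 * ln (2::real)" using ln_realpow[of "2::real" 2] by simp
  moreover have "ln (2::real) \<le> 1" using ln_le_minus_one[of "2::real"] by simp
  ultimately have ln4: "ln (real (4 * H)) \<le> 2 + ln (real H)" by linarith
  have "0 \<le> C powr (- 1) * ln (real H)" using lnH by simp
  then have "KH \<le> 60 + C powr (- 1) + 60 * ln (real H) + C powr (- 1) * ln (real H)"
    unfolding KH_def using ln4 lnH by argo
  then have KH: "KH \<le> K * (1 + ln (real H))"
    unfolding K_def by (simp add: algebra_simps)
  have KH0: "KH \<ge> 0" unfolding KH_def using H by (intro add_nonneg_nonneg mult_nonneg_nonneg) auto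
  have "(\<Sum>h=1..H. dist_int (real h * \<alpha>) powr (- 1) / real h) \<le>
      KH * (real H powr 0 + (\<Sum>q=1..H. real q powr (0 - 1)))"
  proof (rule sum_inverse_weighted_le[OF H KH0])
    fix q assume q: "1 \<le> q" "q \<le> H"
    have "(\<Sum>h=1..q. dist_int (real h * \<alpha>) powr (- 1)) \<le>
        10 * 2 powr 1 * (1 + ln (real (4 * H))) * real q + C powr (- 1) * real q powr (max 1 (1 * 1))"
    proof (rule sum_dist_int_powr_le[OF C _ q(1) dioph])
      fix m :: nat assume m: "1 \<le> m" "m \<le> 4 * q"
      have "ln (real m) \<le> ln (real (4 * H))" using m q by (subst ln_le_cancel_iff) auto
      then have "(\<Sum>r=1..m. real r powr (- 1)) \<le> 1 + ln (real (4 * H))"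
        using sum_inverse_le_ln[OF m(1)] by linarith
      then show "real m powr (1 - 1) * (\<Sum>r=1..m. real r powr (- 1)) \<le> 1 + ln (real (4 * H))"
        using m by simp
    qed auto
    then show "(\<Sum>h=1..q. dist_int (real h * \<alpha>) powr (- 1)) \<le> KH * real q powr (0 + 1)"
      using q by (simp add: KH_def distrib_right)
  qed
  also have "\<dots> \<le> KH * (1 + (1 + ln (real H)))"
    using sum_inverse_le_ln[OF H] KH0 H by (intro mult_left_mono add_mono) auto
  also have "\<dots> \<le> (K * (1 + ln (real H))) * (2 * (1 + ln (real H)))"
    using KH KH0 lnH by (intro mult_mono) auto
  finally show "(\<Sum>h=1..H. dist_int (real h * \<alpha>) powr (- 1) / real h) \<le> 2 * K * (1 + ln (real H))\<^sup>2"
    by (simp add: power2_eq_square mult_ac)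
qed

text \<open>Here the exponent p = \<gamma> b - 1 is positive, so partial summation costs only the
  constant 2 + 1/p.\<close>

lemma weighted_dist_int_sum_powr:
  fixes \<alpha> \<gamma> C b :: real
  assumes C: "C > 0" and b: "0 < b" "b \<le> 1" "\<gamma> * b > 1"
    and dioph: "\<And>q::nat. q \<ge> 1 \<Longrightarrow> dist_int (real q * \<alpha>) \<ge> C * real q powr (- \<gamma>)"
  obtains K where "K > 0"
    "\<And>H. H \<ge> 1 \<Longrightarrow> (\<Sum>h=1..H. dist_int (real h * \<alpha>) powr (- b) / real h) \<le> K * real H powr (\<gamma> * b - 1)"
proof -
  obtain K where K: "K > 0"
    "\<And>Q. Q \<ge> 1 \<Longrightarrow> (\<Sum>h=1..Q. dist_int (real h * \<alpha>) powr (- b)) \<le> K * real Q powr (max 1 (\<gamma> * b))"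
    using sum_dist_int_powr_bigo[of C b \<gamma> \<alpha>] assms by metis
  define p where "p = \<gamma> * b - 1"
  have p: "p > 0" "max 1 (\<gamma> * b) = p + 1" using b by (auto simp: p_def)
  show ?thesis
  proof (rule that)
    show "K * (2 + 1 / p) > 0" using K p by (simp add: add_pos_pos)
    fix H :: nat assume H: "H \<ge> 1"
    have "(\<Sum>h=1..H. dist_int (real h * \<alpha>) powr (- b) / real h) \<le>
        K * (real H powr p + (\<Sum>q=1..H. real q powr (p - 1)))"
      using K p by (intro sum_inverse_weighted_le[OF H]) auto
    also have "\<dots> \<le> K * (real H powr p + (1 + 1 / p) * real H powr p)"
      using K p by (intro mult_left_mono add_left_mono sum_powr_le_powr) auto
    also have "\<dots> = K * (2 + 1 / p) * real H powr p" by (simp add: algebra_simps)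
    finally show "(\<Sum>h=1..H. dist_int (real h * \<alpha>) powr (- b) / real h) \<le> K * (2 + 1 / p) * real H powr (\<gamma> * b - 1)"
      by (simp add: p_def)
  qed
qed

section \<open>Exponential moments of exponential sums along a random walk\<close>

lemma measurable_cis [measurable]: "cis \<in> borel_measurable borel"
  by (intro borel_measurable_continuous_onI continuous_on_cis continuous_on_id)

text \<open>Taylor with Lagrange remainder. The range 4 is what occurs below: a parameter of at most
  2 times an increment of modulus at most 2.\<close>

lemma exp_le_quadratic:
  fixes y :: real
  assumes "\<bar>y\<bar> \<le> 4"
  shows "exp y \<le> 1 + y + exp 4 * y\<^sup>2"
proof -
  obtain t where t: "\<bar>t\<bar> \<le> \<bar>y\<bar>" "exp y = (\<Sum>m<2. y ^ m / fact m) + exp t / fact 2 * y ^ 2"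
    using Maclaurin_exp_le[of y 2] by blast
  have "exp t / 2 * y\<^sup>2 \<le> exp 4 * y\<^sup>2"
  proof (rule mult_right_mono)
    have "exp t \<le> exp 4" using t assms by simp
    then show "exp t / 2 \<le> exp 4" using exp_gt_zero[of "4::real"] by linarith
  qed simp
  then show ?thesis using t(2) by (simp add: eval_nat_numeral)
qed

text \<open>Replaces the modulus by four real linear functionals, to which real martingale arguments
  apply. The price is the doubled parameter, from AM-GM on the product of the exponentials of |Re z|
  and |Im z|.\<close>

lemma exp_norm_le_sum_directions:
  fixes z :: complex
  assumes "l \<ge> 0"
  shows "exp (l * cmod z) \<le> (\<Sum>u\<in>{1, -1, \<i>, -\<i>}. exp (2 * l * Re (u * z))) / 2"
proof -
  have "exp (l * cmod z) \<le> exp (l * \<bar>Re z\<bar> + l * \<bar>Im z\<bar>)"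
    using assms cmod_le[of z] by (simp flip: distrib_left add: mult_left_mono)
  also have "\<dots> = exp (l * \<bar>Re z\<bar>) * exp (l * \<bar>Im z\<bar>)"
    by (rule exp_add)
  also have "\<dots> \<le> ((exp (l * \<bar>Re z\<bar>))\<^sup>2 + (exp (l * \<bar>Im z\<bar>))\<^sup>2) / 2"
    using sum_squares_bound[of "exp (l * \<bar>Re z\<bar>)" "exp (l * \<bar>Im z\<bar>)"] by simp
  also have "\<dots> = (exp (2 * l * \<bar>Re z\<bar>) + exp (2 * l * \<bar>Im z\<bar>)) / 2"
    by (simp flip: exp_double add: mult.assoc)
  also have "exp (2 * l * \<bar>Re z\<bar>) \<le> exp (2 * l * Re z) + exp (- (2 * l * Re z))"
    by (cases "Re z \<ge> 0") auto
  also have "exp (2 * l * \<bar>Im z\<bar>) \<le> exp (2 * l * Im z) + exp (- (2 * l * Im z))"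
    by (cases "Im z \<ge> 0") auto
  finally show ?thesis by (simp add: complex_eq_iff add_ac)
qed

section \<open>Histories of the sequence, independence and the maximal inequality\<close>

locale iid_sequence = prob_space M for M :: "'a measure" +
  fixes X :: "nat \<Rightarrow> 'a \<Rightarrow> real"
  assumes indep: "indep_vars (\<lambda>_. borel) X {1..}"
    and ident: "\<And>j. j \<ge> 1 \<Longrightarrow> distr M borel (X j) = distr M borel (X 1)"
begin

text \<open>A measure used only as a carrier of the sigma-algebra generated by the X i with i in I.
  Being adapted then means being measurable from \<open>hist n\<close>.\<close>

definition sigma_X :: "nat set \<Rightarrow> 'a measure" where
  "sigma_X I = vimage_algebra (space M) (\<lambda>\<omega>. restrict (\<lambda>i. X i \<omega>) I) (PiM I (\<lambda>_. borel))"

abbreviation hist :: "nat \<Rightarrow> 'a measure" where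
  "hist n \<equiv> sigma_X {1..n}"

lemma space_sigma_X [simp]: "space (sigma_X I) = space M"
  by (simp add: sigma_X_def)

lemma X_measurable: "j \<ge> 1 \<Longrightarrow> X j \<in> borel_measurable M"
  using indep by (auto simp: indep_vars_def)

lemma restrict_X_measurable:
  "I \<subseteq> {1..} \<Longrightarrow> (\<lambda>\<omega>. restrict (\<lambda>i. X i \<omega>) I) \<in> measurable M (PiM I (\<lambda>_. borel))"
  by (auto intro!: measurable_restrict X_measurable)

lemma X_measurable_sigma_X: "j \<in> I \<Longrightarrow> X j \<in> borel_measurable (sigma_X I)"
proof -
  assume j: "j \<in> I"
  have "(\<lambda>\<omega>. restrict (\<lambda>i. X i \<omega>) I) \<in> measurable (sigma_X I) (PiM I (\<lambda>_. borel))"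
    unfolding sigma_X_def by (rule measurable_vimage_algebra1) (auto simp: space_PiM)
  then have "(\<lambda>\<omega>. (restrict (\<lambda>i. X i \<omega>) I) j) \<in> borel_measurable (sigma_X I)"
    by (rule measurable_compose[OF _ measurable_component_singleton]) (use j in auto)
  then show ?thesis using j by simp
qed

lemma id_measurable_sigma_X: "I \<subseteq> {1..} \<Longrightarrow> (\<lambda>\<omega>. \<omega>) \<in> measurable M (sigma_X I)"
  unfolding sigma_X_def by (rule measurable_vimage_algebra2) (auto intro!: restrict_X_measurable)

lemma measurable_hist_imp: "f \<in> measurable (hist n) N \<Longrightarrow> f \<in> measurable M N"
  by (rule measurable_compose[OF id_measurable_sigma_X, of "{1..n}"]) simp_all

lemma measurable_hist_mono: "m \<le> n \<Longrightarrow> f \<in> measurable (hist m) N \<Longrightarrow> f \<in> measurable (hist n) N"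
proof -
  assume mn: "m \<le> n" and f: "f \<in> measurable (hist m) N"
  have "(\<lambda>\<omega>. \<omega>) \<in> measurable (hist n) (hist m)"
    unfolding sigma_X_def[of "{1..m}"]
    by (rule measurable_vimage_algebra2)
      (use mn in \<open>auto intro!: measurable_restrict X_measurable_sigma_X\<close>)
  from measurable_compose[OF this f] show ?thesis by simp
qed

text \<open>Independence of disjoint blocks is restated for identity maps, so that any function
  measurable with respect to a block can be composed with it.\<close>

lemma indep_var_sigma_X:
  assumes "I \<inter> J = {}" "I \<subseteq> {1..}" "J \<subseteq> {1..}"
  shows "indep_var (sigma_X I) (\<lambda>\<omega>. \<omega>) (sigma_X J) (\<lambda>\<omega>. \<omega>)"
proof -
  have "{(\<lambda>\<omega>. \<omega>) -` A \<inter> space M |A. A \<in> sets (sigma_X I)} =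
      {(\<lambda>\<omega>. restrict (\<lambda>i. X i \<omega>) I) -` A \<inter> space M |A. A \<in> sets (PiM I (\<lambda>_. borel))}"
    if "I \<subseteq> {1..}" for I
  proof -
    have "(\<lambda>\<omega>. restrict (\<lambda>i. X i \<omega>) I) \<in> space M \<rightarrow> space (PiM I (\<lambda>_. borel))"
      by (auto simp: space_PiM)
    from sets_vimage_algebra2[OF this] show ?thesis
      unfolding sigma_X_def by auto
  qed
  then show ?thesis
    using indep_var_restrict[OF indep assms] assms
    by (simp add: indep_var_eq id_measurable_sigma_X)
qed

text \<open>Takes the place of conditional expectation: the next variable is tested against bounded
  functions of the past. The value type is general because both complex and real weights
  occur.\<close>

lemma expectation_hist_mult:
  fixes G :: "'a \<Rightarrow> 'b::{real_normed_field, banach, second_countable_topology}" and f :: "real \<Rightarrow> 'b"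
  assumes G: "G \<in> borel_measurable (hist n)" "\<And>\<omega>. norm (G \<omega>) \<le> B"
    and f: "f \<in> borel_measurable borel" "\<And>x. norm (f x) \<le> K"
  shows "expectation (\<lambda>\<omega>. G \<omega> * f (X (Suc n) \<omega>)) = expectation G * expectation (\<lambda>\<omega>. f (X 1 \<omega>))"
proof -
  have X[measurable]: "X 1 \<in> borel_measurable M" "X (Suc n) \<in> borel_measurable M"
    by (auto intro: X_measurable)
  have [measurable]: "f \<in> borel_measurable borel" by fact
  have "indep_var borel (G \<circ> (\<lambda>\<omega>. \<omega>)) borel ((\<lambda>\<omega>. f (X (Suc n) \<omega>)) \<circ> (\<lambda>\<omega>. \<omega>))"
    by (rule indep_var_compose[OF indep_var_sigma_X[of "{1..n}" "{Suc n}"] G(1)])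
      (auto intro!: measurable_compose[OF X_measurable_sigma_X f(1)])
  then have "expectation (\<lambda>\<omega>. G \<omega> * f (X (Suc n) \<omega>)) = expectation G * expectation (\<lambda>\<omega>. f (X (Suc n) \<omega>))"
    unfolding o_def
  proof (rule indep_var_lebesgue_integral)
    show "integrable M G"
      by (rule integrable_const_bound[of _ B]) (auto intro!: measurable_hist_imp[OF G(1)] G(2))
    show "integrable M (\<lambda>\<omega>. f (X (Suc n) \<omega>))"
      by (rule integrable_const_bound[of _ K]) (auto intro!: f(2))
  qed
  also have "expectation (\<lambda>\<omega>. f (X (Suc n) \<omega>)) = expectation (\<lambda>\<omega>. f (X 1 \<omega>))"
    using integral_distr[OF X(2) f(1)] integral_distr[OF X(1) f(1)] ident[of "Suc n"] by simp
  finally show ?thesis .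
qed

text \<open>Pathwise argument of Acciaio et al.: the expectation of \<open>m s - m\<^sup>2 / 2\<close> does not decrease in \<open>n\<close>.\<close>

lemma doob_L2:
  fixes s :: "nat \<Rightarrow> 'a \<Rightarrow> real" and B :: "nat \<Rightarrow> real"
  assumes adapted: "\<And>n. s n \<in> borel_measurable (hist n)"
    and nonneg: "\<And>n \<omega>. 0 \<le> s n \<omega>" and bounded: "\<And>n \<omega>. s n \<omega> \<le> B n"
    and submart: "\<And>n G K. G \<in> borel_measurable (hist n) \<Longrightarrow> (\<And>\<omega>. 0 \<le> G \<omega>) \<Longrightarrow> (\<And>\<omega>. G \<omega> \<le> K) \<Longrightarrow>
        expectation (\<lambda>\<omega>. G \<omega> * s n \<omega>) \<le> expectation (\<lambda>\<omega>. G \<omega> * s (Suc n) \<omega>)"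
  defines "m \<equiv> \<lambda>n \<omega>. Max ((\<lambda>k. s k \<omega>) ` {..n})"
  shows "expectation (\<lambda>\<omega>. (m N \<omega>)\<^sup>2) \<le> 4 * expectation (\<lambda>\<omega>. (s N \<omega>)\<^sup>2)"
proof -
  have m_hist: "m n \<in> borel_measurable (hist n)" for n
    unfolding m_def by (intro borel_measurable_Max measurable_hist_mono[OF _ adapted]) auto
  have m_Suc: "m (Suc n) \<omega> = max (s (Suc n) \<omega>) (m n \<omega>)" for n \<omega>
    by (simp add: m_def atMost_Suc)
  have m_nonneg: "0 \<le> m n \<omega>" for n \<omega>
    unfolding m_def using nonneg by (subst Max_ge_iff) auto
  define B' where "B' = (\<lambda>n. Max (B ` {..n}))"
  have m_le: "m n \<omega> \<le> B' n" for n \<omega>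
    unfolding m_def B'_def using bounded
    by (subst Max_le_iff) (auto simp: Max_ge_iff intro: order_trans)
  note s_meas [measurable] = measurable_hist_imp[OF adapted]
  note m_meas [measurable] = measurable_hist_imp[OF m_hist]
  have int_ms: "integrable M (\<lambda>\<omega>. m n \<omega> * s k \<omega>)" for n k
    by (rule integrable_const_bound[of _ "B' n * B k"])
      (use m_nonneg m_le nonneg bounded in \<open>auto simp: abs_mult intro!: AE_I2 mult_mono order_trans[OF m_nonneg m_le]\<close>)
  have int_mm: "integrable M (\<lambda>\<omega>. (m n \<omega>)\<^sup>2)" for n
    by (rule integrable_const_bound[of _ "(B' n)\<^sup>2"])
      (use m_nonneg m_le in \<open>auto intro!: AE_I2 power_mono\<close>)
  have int_ss: "integrable M (\<lambda>\<omega>. (s n \<omega>)\<^sup>2)" for n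
    by (rule integrable_const_bound[of _ "(B n)\<^sup>2"])
      (use nonneg bounded in \<open>auto intro!: AE_I2 power_mono\<close>)
  have key: "0 \<le> expectation (\<lambda>\<omega>. m n \<omega> * s n \<omega> - (m n \<omega>)\<^sup>2 / 2)" for n
  proof (induction n)
    case 0
    show ?case by (rule integral_nonneg_AE) (auto simp: m_def power2_eq_square)
  next
    case (Suc n)
    note Suc.IH
    also have "expectation (\<lambda>\<omega>. m n \<omega> * s n \<omega> - (m n \<omega>)\<^sup>2 / 2) =
        expectation (\<lambda>\<omega>. m n \<omega> * s n \<omega>) - expectation (\<lambda>\<omega>. (m n \<omega>)\<^sup>2 / 2)"
      by (rule Bochner_Integration.integral_diff) (auto intro: int_ms int_mm)
    also have "\<dots> \<le> expectation (\<lambda>\<omega>. m n \<omega> * s (Suc n) \<omega>) - expectation (\<lambda>\<omega>. (m n \<omega>)\<^sup>2 / 2)"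
      by (intro diff_right_mono submart[OF m_hist m_nonneg m_le])
    also have "\<dots> = expectation (\<lambda>\<omega>. m n \<omega> * s (Suc n) \<omega> - (m n \<omega>)\<^sup>2 / 2)"
      by (rule Bochner_Integration.integral_diff[symmetric]) (auto intro: int_ms int_mm)
    also have "\<dots> \<le> expectation (\<lambda>\<omega>. m (Suc n) \<omega> * s (Suc n) \<omega> - (m (Suc n) \<omega>)\<^sup>2 / 2)"
    proof (intro integral_mono Bochner_Integration.integrable_diff)
      fix \<omega>
      show "m n \<omega> * s (Suc n) \<omega> - (m n \<omega>)\<^sup>2 / 2 \<le> m (Suc n) \<omega> * s (Suc n) \<omega> - (m (Suc n) \<omega>)\<^sup>2 / 2"
      proof (cases "s (Suc n) \<omega> \<le> m n \<omega>")
        case False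
        \<comment> \<open>When a new maximum is reached, the gain is half of this square.\<close>
        have "0 \<le> (m n \<omega> - s (Suc n) \<omega>)\<^sup>2" by simp
        then show ?thesis using False by (simp add: m_Suc power2_eq_square algebra_simps)
      qed (simp add: m_Suc max_def)
    qed (auto intro: int_ms int_mm)
    finally show ?case .
  qed
  have "expectation (\<lambda>\<omega>. (m N \<omega>)\<^sup>2) \<le> expectation (\<lambda>\<omega>. (m N \<omega>)\<^sup>2) + 4 * expectation (\<lambda>\<omega>. m N \<omega> * s N \<omega> - (m N \<omega>)\<^sup>2 / 2)"
    using key[of N] by simp
  also have "\<dots> = expectation (\<lambda>\<omega>. (m N \<omega>)\<^sup>2 + 4 * (m N \<omega> * s N \<omega> - (m N \<omega>)\<^sup>2 / 2))"
    by (simp add: int_ms int_mm)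
  also have "\<dots> \<le> expectation (\<lambda>\<omega>. 4 * (s N \<omega>)\<^sup>2)"
  proof (rule integral_mono)
    fix \<omega>
    \<comment> \<open>Completing the square: - m^2 + 4 m s \<le> 4 s^2, which is the source of the
      constant 4.\<close>
    have "0 \<le> (m N \<omega> - 2 * s N \<omega>)\<^sup>2" by simp
    then show "(m N \<omega>)\<^sup>2 + 4 * (m N \<omega> * s N \<omega> - (m N \<omega>)\<^sup>2 / 2) \<le> 4 * (s N \<omega>)\<^sup>2"
      by (simp add: power2_eq_square algebra_simps)
  qed (intro Bochner_Integration.integrable_add Bochner_Integration.integrable_diff
      integrable_mult_right integrable_divide int_ms int_mm int_ss)+
  finally show ?thesis by simp
qed

section \<open>The martingale of a frequency and its exponential moments\<close>

definition chf :: "real \<Rightarrow> complex" where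
  "chf t = char (distr M borel (X 1)) t"

definition phase :: "real \<Rightarrow> nat \<Rightarrow> 'a \<Rightarrow> complex" where
  "phase t k \<omega> = cis (t * (\<Sum>j=1..k. X j \<omega>))"

definition exp_sum :: "real \<Rightarrow> nat \<Rightarrow> 'a \<Rightarrow> complex" where
  "exp_sum t n \<omega> = (\<Sum>k=1..n. phase t k \<omega>)"

text \<open>The increments are \<open>phase t (Suc k) \<omega> - chf t * phase t k \<omega>\<close>,
  factored into a unimodular function of the past and a centred function of the next
  variable.\<close>

definition mart :: "real \<Rightarrow> nat \<Rightarrow> 'a \<Rightarrow> complex" where
  "mart t n \<omega> = (\<Sum>k<n. phase t k \<omega> * (cis (t * X (Suc k) \<omega>) - chf t))"

lemma X1_measurable [measurable]: "X (Suc 0) \<in> borel_measurable M"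
  using X_measurable[of 1] by simp

lemma integrable_cis_X: "integrable M (\<lambda>\<omega>. cis (t * X (Suc 0) \<omega>))"
  by (rule integrable_const_bound[of _ 1]) auto

lemma chf_eq: "chf t = expectation (\<lambda>\<omega>. cis (t * X (Suc 0) \<omega>))"
  unfolding chf_def char_def
  by (subst integral_distr) (auto simp: cis_conv_exp)

lemma norm_chf_le: "cmod (chf t) \<le> 1"
proof -
  have "cmod (chf t) \<le> expectation (\<lambda>\<omega>. cmod (cis (t * X (Suc 0) \<omega>)))"
    unfolding chf_eq by (rule integral_norm_bound)
  then show ?thesis by (simp add: prob_space)
qed

lemma expectation_centered: "expectation (\<lambda>\<omega>. cis (t * X (Suc 0) \<omega>) - chf t) = 0"
  by (subst Bochner_Integration.integral_diff) (auto simp: integrable_cis_X prob_space chf_eq)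

text \<open>This is the conditional variance of a martingale increment, because the factor from the
  past has modulus 1.\<close>

lemma expectation_centered_sq:
  "expectation (\<lambda>\<omega>. (cmod (cis (t * X (Suc 0) \<omega>) - chf t))\<^sup>2) = 1 - (cmod (chf t))\<^sup>2"
proof -
  have sq: "(cmod (cis a - z))\<^sup>2 = 1 + (cmod z)\<^sup>2 - 2 * Re (cis a * cnj z)" for a z
    using sin_cos_squared_add[of a]
    unfolding cmod_power2 by (simp add: power2_eq_square algebra_simps)
  have int: "integrable M (\<lambda>\<omega>. cis (t * X (Suc 0) \<omega>) * cnj (chf t))"
    by (intro integrable_mult_left integrable_cis_X)
  have "expectation (\<lambda>\<omega>. (cmod (cis (t * X (Suc 0) \<omega>) - chf t))\<^sup>2) =
      1 + (cmod (chf t))\<^sup>2 - 2 * expectation (\<lambda>\<omega>. Re (cis (t * X (Suc 0) \<omega>) * cnj (chf t)))"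
  proof -
    define r where "r = (\<lambda>\<omega>. Re (cis (t * X (Suc 0) \<omega>) * cnj (chf t)))"
    have "integrable M r" unfolding r_def by (rule integrable_Re[OF int])
    then have "expectation (\<lambda>\<omega>. 1 + (cmod (chf t))\<^sup>2 - 2 * r \<omega>) = 1 + (cmod (chf t))\<^sup>2 - 2 * expectation r"
      by (simp add: prob_space)
    then show ?thesis unfolding sq r_def .
  qed
  also have "expectation (\<lambda>\<omega>. Re (cis (t * X (Suc 0) \<omega>) * cnj (chf t))) = Re (chf t * cnj (chf t))"
    unfolding integral_Re[OF int] by (simp only: integral_mult_left_zero chf_eq)
  also have "\<dots> = (cmod (chf t))\<^sup>2"
    unfolding cmod_power2 by (simp add: power2_eq_square)
  finally show ?thesis by simp
qed

lemma norm_phase [simp]: "cmod (phase t k \<omega>) = 1"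
  by (simp add: phase_def)

lemma phase_0 [simp]: "phase t 0 \<omega> = 1"
  by (simp add: phase_def)

lemma phase_Suc: "phase t (Suc k) \<omega> = phase t k \<omega> * cis (t * X (Suc k) \<omega>)"
  by (simp add: phase_def cis_mult distrib_left)

lemma mart_Suc: "mart t (Suc n) \<omega> = mart t n \<omega> + phase t n \<omega> * (cis (t * X (Suc n) \<omega>) - chf t)"
  by (simp add: mart_def)

text \<open>The two sums of phases, over 1..n and over 0..n-1, differ only in the end terms
  \<open>phase t n \<omega>\<close> and 1, hence the bounded remainder.\<close>

lemma mart_eq_exp_sum:
  "mart t n \<omega> = (1 - chf t) * exp_sum t n \<omega> + chf t * (phase t n \<omega> - 1)"
proof (induction n)
  case (Suc n)
  then show ?case by (simp add: mart_Suc exp_sum_def phase_Suc algebra_simps)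
qed (simp add: mart_def exp_sum_def)

lemma norm_exp_sum_le:
  "cmod (1 - chf t) * cmod (exp_sum t n \<omega>) \<le> cmod (mart t n \<omega>) + 2"
proof -
  have "cmod (chf t * (phase t n \<omega> - 1)) \<le> 1 * 2"
    unfolding norm_mult using norm_chf_le norm_triangle_ineq4[of "phase t n \<omega>" 1]
    by (intro mult_mono) auto
  moreover have "(1 - chf t) * exp_sum t n \<omega> = mart t n \<omega> - chf t * (phase t n \<omega> - 1)"
    by (simp add: mart_eq_exp_sum)
  ultimately show ?thesis
    unfolding norm_mult[symmetric]
    using norm_triangle_ineq4[of "mart t n \<omega>" "chf t * (phase t n \<omega> - 1)"] by simp
qed

lemma norm_centered_le: "cmod (cis a - chf t) \<le> 2"
  using norm_triangle_ineq4[of "cis a" "chf t"] norm_chf_le[of t] by simp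

lemma norm_mart_le: "cmod (mart t n \<omega>) \<le> 2 * real n"
proof -
  have "cmod (mart t n \<omega>) \<le> (\<Sum>k<n. 2)"
    unfolding mart_def by (rule sum_norm_le) (simp add: norm_mult norm_centered_le)
  then show ?thesis by simp
qed

lemma phase_hist: "phase t k \<in> borel_measurable (hist k)"
proof -
  have [measurable]: "(\<lambda>\<omega>. \<Sum>j=1..k. X j \<omega>) \<in> borel_measurable (hist k)"
    by (intro borel_measurable_sum X_measurable_sigma_X) auto
  show ?thesis unfolding phase_def[abs_def] by measurable
qed

lemma mart_hist: "mart t n \<in> borel_measurable (hist n)"
  unfolding mart_def[abs_def]
proof (rule borel_measurable_sum)
  fix k assume k: "k \<in> {..<n}"
  have [measurable]: "phase t k \<in> borel_measurable (hist n)"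
    using k by (intro measurable_hist_mono[OF _ phase_hist]) auto
  have [measurable]: "X (Suc k) \<in> borel_measurable (hist n)"
    using k by (intro X_measurable_sigma_X) auto
  show "(\<lambda>\<omega>. phase t k \<omega> * (cis (t * X (Suc k) \<omega>) - chf t)) \<in> borel_measurable (hist n)"
    by measurable
qed

lemma exp_mart_hist: "(\<lambda>\<omega>. exp (l * Re (u * mart t n \<omega>))) \<in> borel_measurable (hist n)"
proof -
  note [measurable] = mart_hist[of t n]
  show ?thesis by measurable
qed

lemma Re_mart_le:
  assumes "cmod u = 1" shows "\<bar>Re (u * mart t n \<omega>)\<bar> \<le> 2 * real n"
  using abs_Re_le_cmod[of "u * mart t n \<omega>"] norm_mart_le[of t n \<omega>] assms by (simp add: norm_mult)

lemma exp_mart_le: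
  assumes "cmod u = 1" "0 \<le> l" shows "exp (l * Re (u * mart t n \<omega>)) \<le> exp (l * (2 * real n))"
  using Re_mart_le[OF assms(1), of t n \<omega>] assms(2) by (simp add: mult_left_mono abs_le_iff)

text \<open>The martingale property in tested form: \<open>G\<close>, \<open>u\<close> and the phase
  combine into one complex weight from the past, which is independent of the centred factor.\<close>

lemma expectation_hist_increment:
  fixes G :: "'a \<Rightarrow> real"
  assumes G: "G \<in> borel_measurable (hist n)" "\<And>\<omega>. \<bar>G \<omega>\<bar> \<le> B"
  shows "expectation (\<lambda>\<omega>. G \<omega> * Re (u * (phase t n \<omega> * (cis (t * X (Suc n) \<omega>) - chf t)))) = 0"
    and "integrable M (\<lambda>\<omega>. G \<omega> * Re (u * (phase t n \<omega> * (cis (t * X (Suc n) \<omega>) - chf t))))"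
proof -
  note [measurable] = G(1) phase_hist[of t n] measurable_hist_imp[OF phase_hist[of t n]]
    measurable_hist_imp[OF G(1)] X_measurable[of "Suc n", simplified]
  define f where "f = (\<lambda>\<omega>. (complex_of_real (G \<omega>) * u * phase t n \<omega>) * (cis (t * X (Suc n) \<omega>) - chf t))"
  have eq: "G \<omega> * Re (u * (phase t n \<omega> * (cis (t * X (Suc n) \<omega>) - chf t))) = Re (f \<omega>)" for \<omega>
    by (simp add: f_def algebra_simps)
  have B: "cmod (complex_of_real (G \<omega>) * u * phase t n \<omega>) \<le> B * cmod u" for \<omega>
    using G(2)[of \<omega>] by (simp add: norm_mult mult_right_mono)
  have int: "integrable M f"
  proof (rule integrable_const_bound[of _ "B * cmod u * 2"])
    show "AE \<omega> in M. cmod (f \<omega>) \<le> B * cmod u * 2"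
      unfolding f_def norm_mult[of "_ * _ * _"] using B order_trans[OF norm_ge_zero B]
      by (intro AE_I2 mult_mono norm_centered_le) auto
    show "f \<in> borel_measurable M" unfolding f_def by measurable
  qed
  have "expectation f = expectation (\<lambda>\<omega>. complex_of_real (G \<omega>) * u * phase t n \<omega>) *
      expectation (\<lambda>\<omega>. cis (t * X 1 \<omega>) - chf t)"
    unfolding f_def
  proof (rule expectation_hist_mult[where f="\<lambda>x. cis (t * x) - chf t", OF _ B _ norm_centered_le])
    show "(\<lambda>\<omega>. complex_of_real (G \<omega>) * u * phase t n \<omega>) \<in> borel_measurable (hist n)" by measurable
    show "(\<lambda>x. cis (t * x) - chf t) \<in> borel_measurable borel" by measurable
  qed
  then have "expectation f = 0" by (simp add: expectation_centered)
  then show "expectation (\<lambda>\<omega>. G \<omega> * Re (u * (phase t n \<omega> * (cis (t * X (Suc n) \<omega>) - chf t)))) = 0"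
    unfolding eq integral_Re[OF int] by simp
  show "integrable M (\<lambda>\<omega>. G \<omega> * Re (u * (phase t n \<omega> * (cis (t * X (Suc n) \<omega>) - chf t))))"
    unfolding eq by (rule integrable_Re[OF int])
qed

lemma integrable_hist_exp_mart:
  fixes G :: "'a \<Rightarrow> real"
  assumes G: "G \<in> borel_measurable (hist n)" "\<And>\<omega>. \<bar>G \<omega>\<bar> \<le> B" and u: "cmod u = 1" "0 \<le> l"
  shows "integrable M (\<lambda>\<omega>. G \<omega> * exp (l * Re (u * mart t k \<omega>)))"
proof -
  note [measurable] = measurable_hist_imp[OF exp_mart_hist[of l u t k]] measurable_hist_imp[OF G(1)]
  show ?thesis
  proof (rule integrable_const_bound[of _ "B * exp (l * (2 * real k))"])
    show "AE \<omega> in M. norm (G \<omega> * exp (l * Re (u * mart t k \<omega>))) \<le> B * exp (l * (2 * real k))"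
      unfolding real_norm_def abs_mult abs_exp_cancel
      by (intro AE_I2 mult_mono G(2) exp_mart_le u order_trans[OF abs_ge_zero G(2)]) auto
    show "(\<lambda>\<omega>. G \<omega> * exp (l * Re (u * mart t k \<omega>))) \<in> borel_measurable M" by measurable
  qed
qed

lemma integrable_exp_mart:
  "cmod u = 1 \<Longrightarrow> 0 \<le> l \<Longrightarrow> integrable M (\<lambda>\<omega>. exp (l * Re (u * mart t k \<omega>)))"
  using integrable_hist_exp_mart[of "\<lambda>_. 1" 0 1] by simp

text \<open>From exp x \<ge> 1 + x: the linear term is a martingale increment tested against the
  past and has expectation 0. The tested form is the one \<open>doob_L2\<close> asks for.\<close>

lemma exp_mart_submartingale:
  fixes G :: "'a \<Rightarrow> real"
  assumes G: "G \<in> borel_measurable (hist n)" "\<And>\<omega>. 0 \<le> G \<omega>" "\<And>\<omega>. G \<omega> \<le> B" and u: "cmod u = 1" "0 \<le> l"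
  shows "expectation (\<lambda>\<omega>. G \<omega> * exp (l * Re (u * mart t n \<omega>)))
      \<le> expectation (\<lambda>\<omega>. G \<omega> * exp (l * Re (u * mart t (Suc n) \<omega>)))"
proof -
  define A where "A = (\<lambda>\<omega>. G \<omega> * exp (l * Re (u * mart t n \<omega>)) * l)"
  define I where "I = (\<lambda>\<omega>. Re (u * (phase t n \<omega> * (cis (t * X (Suc n) \<omega>) - chf t))))"
  note [measurable] = G(1) exp_mart_hist[of l u t n]
  have A: "A \<in> borel_measurable (hist n)" unfolding A_def by measurable
  have A_le: "\<bar>A \<omega>\<bar> \<le> B * exp (l * (2 * real n)) * l" for \<omega>
    using G(2,3)[of \<omega>] exp_mart_le[OF u, of t n \<omega>] u
    unfolding A_def by (auto simp: abs_mult intro!: mult_mono)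
  have absG: "\<bar>G \<omega>\<bar> \<le> B" for \<omega> using G(2,3)[of \<omega>] by simp
  have inc: "expectation (\<lambda>\<omega>. A \<omega> * I \<omega>) = 0" "integrable M (\<lambda>\<omega>. A \<omega> * I \<omega>)"
    unfolding I_def by (rule expectation_hist_increment[OF A A_le])+
  have "expectation (\<lambda>\<omega>. G \<omega> * exp (l * Re (u * mart t n \<omega>))) =
      expectation (\<lambda>\<omega>. G \<omega> * exp (l * Re (u * mart t n \<omega>)) + A \<omega> * I \<omega>)"
    by (subst Bochner_Integration.integral_add[OF integrable_hist_exp_mart[OF G(1) absG u] inc(2)])
      (simp only: inc(1) add_0_right)
  also have "\<dots> \<le> expectation (\<lambda>\<omega>. G \<omega> * exp (l * Re (u * mart t (Suc n) \<omega>)))"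
  proof (rule integral_mono)
    fix \<omega>
    have "G \<omega> * exp (l * Re (u * mart t n \<omega>)) * (1 + l * I \<omega>) \<le>
        G \<omega> * exp (l * Re (u * mart t n \<omega>)) * exp (l * I \<omega>)"
      using G(2)[of \<omega>] by (intro mult_left_mono exp_ge_add_one_self) auto
    then show "G \<omega> * exp (l * Re (u * mart t n \<omega>)) + A \<omega> * I \<omega> \<le> G \<omega> * exp (l * Re (u * mart t (Suc n) \<omega>))"
      by (simp add: A_def I_def mart_Suc exp_add[symmetric] distrib_left mult.assoc)
  qed (intro Bochner_Integration.integrable_add integrable_hist_exp_mart[OF G(1) absG u] inc)+
  finally show ?thesis .
qed

text \<open>Each step costs one factor. Expanding the exponential of the increment to second order,
  the linear term vanishes in expectation, and the quadratic one is at most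
  \<open>exp 4 * l\<^sup>2\<close> times a squared modulus that is independent of the past.\<close>

lemma expectation_exp_mart_le:
  assumes u: "cmod u = 1" and l: "0 \<le> l" "l \<le> 2"
  shows "expectation (\<lambda>\<omega>. exp (l * Re (u * mart t n \<omega>))) \<le> (1 + exp 4 * l\<^sup>2 * (1 - (cmod (chf t))\<^sup>2)) ^ n"
proof (induction n)
  case 0
  show ?case by (simp add: mart_def prob_space)
next
  case (Suc n)
  define q where "q = exp 4 * l\<^sup>2"
  define v where "v = 1 - (cmod (chf t))\<^sup>2"
  have q: "q \<ge> 0" by (simp add: q_def)
  have v: "v \<ge> 0" using norm_chf_le[of t] by (simp add: v_def power_le_one)
  define A where "A = (\<lambda>\<omega>. exp (l * Re (u * mart t n \<omega>)))"
  define \<zeta> where "\<zeta> = (\<lambda>\<omega>. cis (t * X (Suc n) \<omega>) - chf t)"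
  define I where "I = (\<lambda>\<omega>. Re (u * (phase t n \<omega> * \<zeta> \<omega>)))"
  have A: "A \<in> borel_measurable (hist n)" unfolding A_def by (rule exp_mart_hist)
  note [measurable] = A measurable_hist_imp[OF A] X_measurable[of "Suc n", simplified]
  have Al: "(\<lambda>\<omega>. A \<omega> * l) \<in> borel_measurable (hist n)" by measurable
  have Ale: "A \<omega> \<le> exp (l * (2 * real n))" for \<omega> unfolding A_def by (rule exp_mart_le[OF u l(1)])
  have A0: "A \<omega> > 0" for \<omega> by (simp add: A_def)
  have Al_le: "\<bar>A \<omega> * l\<bar> \<le> exp (l * (2 * real n)) * l" for \<omega>
    using Ale[of \<omega>] A0[of \<omega>] l by (auto simp: abs_mult intro!: mult_right_mono)
  have A_norm: "norm (A \<omega>) \<le> exp (l * (2 * real n))" for \<omega> using Ale[of \<omega>] A0[of \<omega>] by simp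
  have inc: "expectation (\<lambda>\<omega>. A \<omega> * l * I \<omega>) = 0" "integrable M (\<lambda>\<omega>. A \<omega> * l * I \<omega>)"
    unfolding I_def \<zeta>_def by (rule expectation_hist_increment[OF Al Al_le])+
  have \<zeta>4: "(cmod (\<zeta> \<omega>))\<^sup>2 \<le> 4" for \<omega>
    using power_mono[OF norm_centered_le norm_ge_zero, of "t * X (Suc n) \<omega>" t 2] by (simp add: \<zeta>_def)
  have intA: "integrable M A" unfolding A_def by (rule integrable_exp_mart[OF u l(1)])
  have int\<zeta>: "integrable M (\<lambda>\<omega>. A \<omega> * (cmod (\<zeta> \<omega>))\<^sup>2)"
  proof (rule integrable_const_bound[of _ "exp (l * (2 * real n)) * 4"])
    show "AE \<omega> in M. norm (A \<omega> * (cmod (\<zeta> \<omega>))\<^sup>2) \<le> exp (l * (2 * real n)) * 4"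
      using A_norm \<zeta>4 by (intro AE_I2) (auto simp: abs_mult intro!: mult_mono)
    show "(\<lambda>\<omega>. A \<omega> * (cmod (\<zeta> \<omega>))\<^sup>2) \<in> borel_measurable M"
      unfolding \<zeta>_def by measurable
  qed
  have E\<zeta>: "expectation (\<lambda>\<omega>. A \<omega> * (cmod (\<zeta> \<omega>))\<^sup>2) = expectation A * v"
  proof -
    have "expectation (\<lambda>\<omega>. A \<omega> * (cmod (\<zeta> \<omega>))\<^sup>2) = expectation A * expectation (\<lambda>\<omega>. (cmod (cis (t * X 1 \<omega>) - chf t))\<^sup>2)"
      unfolding \<zeta>_def
    proof (rule expectation_hist_mult[where f="\<lambda>x. (cmod (cis (t * x) - chf t))\<^sup>2", OF A A_norm])
      show "norm ((cmod (cis (t * x) - chf t))\<^sup>2) \<le> 4" for x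
        using power_mono[OF norm_centered_le norm_ge_zero, of "t * x" t 2] by simp
    qed simp
    then show ?thesis by (simp add: expectation_centered_sq v_def)
  qed
  have "expectation (\<lambda>\<omega>. exp (l * Re (u * mart t (Suc n) \<omega>))) \<le>
      expectation (\<lambda>\<omega>. A \<omega> + A \<omega> * l * I \<omega> + q * (A \<omega> * (cmod (\<zeta> \<omega>))\<^sup>2))"
  proof (rule integral_mono)
    fix \<omega>
    have I\<zeta>: "\<bar>I \<omega>\<bar> \<le> cmod (\<zeta> \<omega>)"
      using abs_Re_le_cmod[of "u * (phase t n \<omega> * \<zeta> \<omega>)"] u by (simp add: I_def norm_mult)
    also have "cmod (\<zeta> \<omega>) \<le> 2" unfolding \<zeta>_def by (rule norm_centered_le)
    finally have "\<bar>l * I \<omega>\<bar> \<le> 2 * 2" unfolding abs_mult using l by (intro mult_mono) auto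
    then have "exp (l * I \<omega>) \<le> 1 + l * I \<omega> + exp 4 * (l * I \<omega>)\<^sup>2"
      by (intro exp_le_quadratic) simp
    also have "exp 4 * (l * I \<omega>)\<^sup>2 \<le> q * (cmod (\<zeta> \<omega>))\<^sup>2"
      using power_mono[OF I\<zeta> abs_ge_zero, of 2] q
      by (simp add: power_mult_distrib q_def mult_left_mono mult.assoc)
    finally have "A \<omega> * exp (l * I \<omega>) \<le> A \<omega> * (1 + l * I \<omega> + q * (cmod (\<zeta> \<omega>))\<^sup>2)"
      using A0[of \<omega>] by (intro mult_left_mono) auto
    moreover have "exp (l * Re (u * mart t (Suc n) \<omega>)) = A \<omega> * exp (l * I \<omega>)"
      by (simp add: A_def I_def \<zeta>_def mart_Suc exp_add[symmetric] distrib_left)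
    ultimately show "exp (l * Re (u * mart t (Suc n) \<omega>)) \<le> A \<omega> + A \<omega> * l * I \<omega> + q * (A \<omega> * (cmod (\<zeta> \<omega>))\<^sup>2)"
      by (simp add: algebra_simps)
  qed (intro Bochner_Integration.integrable_add integrable_mult_right intA inc int\<zeta> integrable_exp_mart u l)+
  also have "\<dots> = expectation A * (1 + q * v)"
    by (subst Bochner_Integration.integral_add;
        (intro Bochner_Integration.integrable_add integrable_mult_right intA inc int\<zeta>)?;
        (subst Bochner_Integration.integral_add)?; (intro intA inc int\<zeta>)?)
      (simp only: inc(1) E\<zeta> integral_mult_right_zero, simp add: algebra_simps)
  also have "\<dots> \<le> (1 + q * v) ^ n * (1 + q * v)"
    using Suc.IH q v unfolding A_def q_def v_def by (intro mult_right_mono) auto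
  finally show ?case by (simp add: q_def v_def mult_ac)
qed

section \<open>Exponential moments of the maximal exponential sum\<close>

definition max_exp_sum :: "real \<Rightarrow> nat \<Rightarrow> 'a \<Rightarrow> real" where
  "max_exp_sum t N \<omega> = Max ((\<lambda>n. cmod (exp_sum t n \<omega>)) ` {..N})"

lemma exp_sum_measurable: "exp_sum t n \<in> borel_measurable M"
  unfolding exp_sum_def[abs_def]
  by (intro borel_measurable_sum measurable_hist_imp[OF phase_hist])

lemma max_exp_sum_measurable: "max_exp_sum t N \<in> borel_measurable M"
proof -
  note [measurable] = exp_sum_measurable
  show ?thesis unfolding max_exp_sum_def[abs_def] by (intro borel_measurable_Max) auto
qed

lemma norm_exp_sum_le_card: "cmod (exp_sum t n \<omega>) \<le> real n"
proof -
  have "cmod (exp_sum t n \<omega>) \<le> (\<Sum>k=1..n. 1)"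
    unfolding exp_sum_def by (rule sum_norm_le) simp
  then show ?thesis by simp
qed

lemma max_exp_sum_bounds: "0 \<le> max_exp_sum t N \<omega>" "max_exp_sum t N \<omega> \<le> real N"
proof -
  show "0 \<le> max_exp_sum t N \<omega>" unfolding max_exp_sum_def by (subst Max_ge_iff) auto
  have "cmod (exp_sum t n \<omega>) \<le> real N" if "n \<le> N" for n
    using norm_exp_sum_le_card[of t n \<omega>] that by linarith
  then show "max_exp_sum t N \<omega> \<le> real N" unfolding max_exp_sum_def by (subst Max_le_iff) auto
qed

lemma max_exp_sum_ge: "n \<le> N \<Longrightarrow> cmod (exp_sum t n \<omega>) \<le> max_exp_sum t N \<omega>"
  unfolding max_exp_sum_def by (rule Max_ge) auto

lemma integrable_exp_max_exp_sum: "0 \<le> c \<Longrightarrow> integrable M (\<lambda>\<omega>. exp (c * max_exp_sum t N \<omega>))"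
proof -
  assume c: "0 \<le> c"
  note [measurable] = max_exp_sum_measurable
  show ?thesis
    by (rule integrable_const_bound[of _ "exp (c * real N)"])
      (use c max_exp_sum_bounds in \<open>auto intro!: AE_I2 mult_left_mono\<close>)
qed

text \<open>The bound is uniform in t and N. If |1 - chf t| < L/N, the trivial bound N for the
  maximum already keeps the exponent below L. Otherwise the sum is compared with the martingale, the
  modulus is split into four directions, and \<open>doob_L2\<close> reduces the maximum to the final
  time.\<close>

lemma expectation_exp_max_le:
  assumes N: "N \<ge> 1" and L: "L \<ge> 0"
  shows "expectation (\<lambda>\<omega>. exp (sqrt (L * cmod (1 - chf t) / real N) * max_exp_sum t N \<omega>))
           \<le> 8 * exp 2 * exp (8 * exp 4 * L)"
proof (cases "cmod (1 - chf t) < L / real N")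
  case True
  have small: "sqrt (L * cmod (1 - chf t) / real N) * max_exp_sum t N \<omega> \<le> L" for \<omega>
  proof -
    have "sqrt (L * cmod (1 - chf t) / real N) * max_exp_sum t N \<omega> \<le> sqrt (L * (L / real N) / real N) * real N"
      using True L max_exp_sum_bounds[of t N \<omega>]
      by (intro mult_mono real_sqrt_le_mono divide_right_mono mult_left_mono) auto
    also have "\<dots> = L" using N L by (simp add: real_sqrt_divide real_sqrt_mult)
    finally show ?thesis .
  qed
  have "expectation (\<lambda>\<omega>. exp (sqrt (L * cmod (1 - chf t) / real N) * max_exp_sum t N \<omega>)) \<le> expectation (\<lambda>\<omega>. exp L)"
    using L by (intro integral_mono integrable_exp_max_exp_sum) (auto simp: small)
  also have "\<dots> = 1 * exp (1 * L)" by (simp add: prob_space)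
  also have "\<dots> \<le> 8 * exp 2 * exp (8 * exp 4 * L)"
  proof -
    have "1 \<le> exp (2::real)" "1 \<le> exp (4::real)" by auto
    then have "1 \<le> 8 * exp (2::real)" "1 \<le> 8 * exp (4::real)" by linarith+
    moreover from this(2) have "1 * L \<le> 8 * exp 4 * L" using L by (rule mult_right_mono)
    ultimately show ?thesis by (intro mult_mono) auto
  qed
  finally show ?thesis .
next
  case False
  define \<delta> where "\<delta> = cmod (1 - chf t)"
  \<comment> \<open>Chosen so that \<open>l * \<delta>\<close> is the given parameter; the second
    regime is exactly where \<open>l\<close> \<le> 1. If \<open>\<delta>\<close> = 0, division by
    zero makes \<open>l\<close> = 0, which agrees with all later steps.\<close>
  define l where "l = sqrt (L / (real N * \<delta>))"
  have \<delta>: "\<delta> \<ge> L / real N" "\<delta> \<ge> 0" using False by (auto simp: \<delta>_def)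
  have l0: "l \<ge> 0" using L \<delta> by (simp add: l_def)
  have l1: "l \<le> 1"
  proof (cases "\<delta> = 0")
    case False
    then have "L / (real N * \<delta>) \<le> 1" using \<delta> N by (simp add: divide_simps mult.commute)
    then show ?thesis by (simp add: l_def)
  qed (simp add: l_def)
  have l\<delta>: "sqrt (L * \<delta> / real N) = l * \<delta>"
  proof (cases "\<delta> = 0")
    case False
    then have "L * \<delta> / real N = (L / (real N * \<delta>)) * \<delta>\<^sup>2" by (simp add: power2_eq_square)
    then show ?thesis using \<delta> by (simp only: real_sqrt_mult l_def real_sqrt_abs)
  qed simp
  let ?U = "{1, -1, \<i>, -\<i>} :: complex set"
  have u1: "cmod u = 1" if "u \<in> ?U" for u using that by auto
  define s where "s = (\<lambda>u n \<omega>. exp (l * Re (u * mart t n \<omega>)))"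
  define m where "m = (\<lambda>u \<omega>. Max ((\<lambda>n. s u n \<omega>) ` {..N}))"
  have pointwise: "exp (sqrt (L * \<delta> / real N) * max_exp_sum t N \<omega>) \<le> exp 2 / 2 * (\<Sum>u\<in>?U. (m u \<omega>)\<^sup>2)" for \<omega>
  proof -
    have "max_exp_sum t N \<omega> \<in> (\<lambda>n. cmod (exp_sum t n \<omega>)) ` {..N}"
      unfolding max_exp_sum_def by (rule Max_in) auto
    then obtain n where n: "n \<le> N" "max_exp_sum t N \<omega> = cmod (exp_sum t n \<omega>)" by auto
    have "sqrt (L * \<delta> / real N) * max_exp_sum t N \<omega> = l * (\<delta> * cmod (exp_sum t n \<omega>))"
      by (simp add: l\<delta> n(2))
    \<comment> \<open>The bounded remainder 2 costs no more than the factor \<open>exp 2\<close>,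
      because \<open>l\<close> \<le> 1.\<close>
    also have "\<dots> \<le> l * (cmod (mart t n \<omega>) + 2)"
      unfolding \<delta>_def using l0 by (intro mult_left_mono norm_exp_sum_le)
    also have "\<dots> \<le> l * cmod (mart t n \<omega>) + 2" using l1 by (simp add: algebra_simps)
    finally have "exp (sqrt (L * \<delta> / real N) * max_exp_sum t N \<omega>) \<le> exp (l * cmod (mart t n \<omega>)) * exp 2"
      by (simp flip: exp_add)
    also have "\<dots> \<le> (\<Sum>u\<in>?U. exp (2 * l * Re (u * mart t n \<omega>))) / 2 * exp 2"
      using l0 by (intro mult_right_mono exp_norm_le_sum_directions) auto
    also have "(\<Sum>u\<in>?U. exp (2 * l * Re (u * mart t n \<omega>))) = (\<Sum>u\<in>?U. (s u n \<omega>)\<^sup>2)"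
      by (intro sum.cong refl) (simp add: s_def flip: exp_double)
    also have "\<dots> / 2 * exp 2 \<le> (\<Sum>u\<in>?U. (m u \<omega>)\<^sup>2) / 2 * exp 2"
    proof (intro mult_right_mono divide_right_mono sum_mono power_mono)
      show "s u n \<omega> \<le> m u \<omega>" for u unfolding m_def using n(1) by (intro Max_ge) auto
    qed (auto simp: s_def)
    finally show ?thesis by (simp add: mult_ac)
  qed
  have s_le: "s u n \<omega> \<le> exp (l * (2 * real n))" if "u \<in> ?U" for u n \<omega>
    unfolding s_def by (rule exp_mart_le[OF u1[OF that] l0])
  have m_meas: "m u \<in> borel_measurable M" for u
    unfolding m_def s_def by (intro borel_measurable_Max measurable_hist_imp[OF exp_mart_hist]) auto
  have int_m: "integrable M (\<lambda>\<omega>. (m u \<omega>)\<^sup>2)" if "u \<in> ?U" for u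
  proof (rule integrable_const_bound[of _ "(exp (l * (2 * real N)))\<^sup>2"])
    have "\<bar>m u \<omega>\<bar> \<le> exp (l * (2 * real N))" for \<omega>
    proof -
      have "m u \<omega> \<in> (\<lambda>n. s u n \<omega>) ` {..N}" unfolding m_def by (rule Max_in) auto
      then obtain n where n: "n \<le> N" "m u \<omega> = s u n \<omega>" by auto
      have "exp (l * (2 * real n)) \<le> exp (l * (2 * real N))" using n l0 by (simp add: mult_left_mono)
      then show ?thesis using s_le[OF that, of n \<omega>] n by (simp add: s_def)
    qed
    then show "AE \<omega> in M. norm ((m u \<omega>)\<^sup>2) \<le> (exp (l * (2 * real N)))\<^sup>2"
      by (intro AE_I2) (simp add: abs_le_square_iff[symmetric])
    show "(\<lambda>\<omega>. (m u \<omega>)\<^sup>2) \<in> borel_measurable M" using m_meas[of u] by simp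
  qed
  have Em: "expectation (\<lambda>\<omega>. (m u \<omega>)\<^sup>2) \<le> 4 * exp (8 * exp 4 * L)" if u: "u \<in> ?U" for u
  proof -
    have "expectation (\<lambda>\<omega>. (m u \<omega>)\<^sup>2) \<le> 4 * expectation (\<lambda>\<omega>. (s u N \<omega>)\<^sup>2)"
      unfolding m_def
    proof (rule doob_L2)
      show "s u n \<in> borel_measurable (hist n)" for n unfolding s_def by (rule exp_mart_hist)
      show "0 \<le> s u n \<omega>" for n \<omega> by (simp add: s_def)
      show "s u n \<omega> \<le> exp (l * (2 * real n))" for n \<omega> by (rule s_le[OF u])
      show "expectation (\<lambda>\<omega>. G \<omega> * s u n \<omega>) \<le> expectation (\<lambda>\<omega>. G \<omega> * s u (Suc n) \<omega>)"
        if "G \<in> borel_measurable (hist n)" "\<And>\<omega>. 0 \<le> G \<omega>" "\<And>\<omega>. G \<omega> \<le> K" for n G K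
        unfolding s_def by (rule exp_mart_submartingale[OF that u1[OF u] l0])
    qed
    also have "(\<lambda>\<omega>. (s u N \<omega>)\<^sup>2) = (\<lambda>\<omega>. exp ((2 * l) * Re (u * mart t N \<omega>)))"
      by (simp add: s_def mult.assoc flip: exp_double)
    also have "expectation \<dots> \<le> (1 + exp 4 * (2 * l)\<^sup>2 * (1 - (cmod (chf t))\<^sup>2)) ^ N"
      using u1[OF u] l0 l1 by (intro expectation_exp_mart_le) auto
    also have "\<dots> \<le> exp (8 * exp 4 * L)"
    proof -
      \<comment> \<open>The variance satisfies 1 - |chf t|^2 \<le> 2 (1 - |chf t|) \<le> 2
        \<open>\<delta>\<close>. Together with the doubled parameter \<open>2 * l\<close> this
        yields the 8 in the exponent.\<close>
      define v where "v = 1 - (cmod (chf t))\<^sup>2"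
      have v0: "v \<ge> 0" using norm_chf_le[of t] by (simp add: v_def power_le_one)
      have "v = (1 + cmod (chf t)) * (1 - cmod (chf t))"
        by (simp add: v_def power2_eq_square algebra_simps)
      also have "\<dots> \<le> 2 * (1 - cmod (chf t))"
        using norm_chf_le[of t] by (intro mult_right_mono) auto
      also have "\<dots> \<le> 2 * \<delta>"
        unfolding \<delta>_def using norm_triangle_ineq2[of 1 "chf t"] by simp
      finally have v: "v \<le> 2 * \<delta>" .
      have "(1 + exp 4 * (2 * l)\<^sup>2 * v) ^ N \<le> exp (exp 4 * (2 * l)\<^sup>2 * v) ^ N"
        using v0 by (intro power_mono exp_ge_add_one_self) auto
      also have "\<dots> = exp (real N * (exp 4 * (2 * l)\<^sup>2 * v))" by (simp add: exp_of_nat_mult)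
      also have "real N * (exp 4 * (2 * l)\<^sup>2 * v) \<le> real N * (exp 4 * (2 * l)\<^sup>2 * (2 * \<delta>))"
        using v by (intro mult_left_mono) auto
      also have "real N * (exp 4 * (2 * l)\<^sup>2 * (2 * \<delta>)) = 8 * exp 4 * (real N * \<delta> * l\<^sup>2)"
        by (simp add: power2_eq_square)
      also have "real N * \<delta> * l\<^sup>2 \<le> L"
        using L N \<delta> by (cases "\<delta> = 0") (auto simp: l_def)
      finally show ?thesis by (simp add: v_def)
    qed
    finally show ?thesis by simp
  qed
  have "expectation (\<lambda>\<omega>. exp (sqrt (L * \<delta> / real N) * max_exp_sum t N \<omega>)) \<le>
      expectation (\<lambda>\<omega>. exp 2 / 2 * (\<Sum>u\<in>?U. (m u \<omega>)\<^sup>2))"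
    using L \<delta> by (intro integral_mono pointwise integrable_exp_max_exp_sum integrable_mult_right
        Bochner_Integration.integrable_sum int_m) auto
  also have "\<dots> = exp 2 / 2 * (\<Sum>u\<in>?U. expectation (\<lambda>\<omega>. (m u \<omega>)\<^sup>2))"
    by (subst Bochner_Integration.integral_sum[symmetric]) (simp_all only: int_m integral_mult_right_zero)
  also have "\<dots> \<le> exp 2 / 2 * (\<Sum>u\<in>?U. 4 * exp (8 * exp 4 * L))"
    by (intro mult_left_mono sum_mono Em) auto
  \<comment> \<open>Four directions times Doob's 4, halved. \<open>complex_eq_iff\<close> shows that
    the directions are distinct, so the sum has four terms.\<close>
  also have "\<dots> = 8 * exp 2 * exp (8 * exp 4 * L)"
    by (simp add: complex_eq_iff)
  finally show ?thesis by (simp add: \<delta>_def)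
qed

end

section \<open>Almost sure bounds for the discrepancy\<close>

lemma ex_dyadic_scale:
  fixes n :: nat assumes "n \<ge> 1" obtains k where "2 ^ k < 2 * n" "n \<le> 2 ^ k"
proof -
  define k where "k = (LEAST k. n \<le> 2 ^ k)"
  have le: "n \<le> 2 ^ k" unfolding k_def
    by (rule LeastI[of _ n]) (simp add: less_imp_le)
  have "2 ^ k < 2 * n"
  proof (cases k)
    case (Suc j)
    then have "\<not> n \<le> 2 ^ j" using not_less_Least[of j "\<lambda>k. n \<le> 2 ^ k"] by (simp add: k_def)
    then show ?thesis using Suc by simp
  qed (use assms in simp)
  then show ?thesis using le that by blast
qed

text \<open>Compares quantities at n with those at its dyadic scale. From k \<ge> 6 on, sqrt k \<le>
  (k - 1)/2 \<le> ln n, hence ln ln n is at least half of ln k.\<close>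

lemma dyadic_ln_bounds:
  fixes n k :: nat
  assumes k: "k \<ge> 6" and n: "2 ^ k < 2 * n" "n \<le> 2 ^ k"
  shows "real k / 4 \<le> ln (real n)" "ln (real k) / 2 ^ k / 2 \<le> ln (ln (real n)) / real n"
proof -
  have n0: "real n > 0" using n(1) by (cases n) auto
  have n2: "2 ^ k < 2 * real n" using n(1) by (metis of_nat_less_iff of_nat_mult of_nat_numeral of_nat_power)
  have n2': "real n \<le> 2 ^ k" using n(2) by (metis of_nat_le_iff of_nat_numeral of_nat_power)
  have k': "real k \<ge> 6" using k by simp
  have "real k * ln 2 = ln (2 ^ k)" by (simp add: ln_realpow)
  also have "\<dots> \<le> ln (2 * real n)" using n2 n0 by (subst ln_le_cancel_iff) auto
  also have "\<dots> = ln 2 + ln (real n)" using n0 by (simp add: ln_mult)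
  finally have "(real k - 1) * ln 2 \<le> ln (real n)" by (simp add: algebra_simps)
  moreover have "(real k - 1) * (1/2) \<le> (real k - 1) * ln 2"
    using ln2_ge_two_thirds k' by (intro mult_left_mono) auto
  ultimately have ln_n: "(real k - 1) / 2 \<le> ln (real n)" by simp
  then show "real k / 4 \<le> ln (real n)" using k' by simp
  have "((real k - 1) / 2)\<^sup>2 - real k = (real k * (real k - 6) + 1) / 4"
    by (simp add: power2_eq_square field_simps)
  also have "\<dots> \<ge> 0" using k' by simp
  finally have "real k \<le> ((real k - 1) / 2)\<^sup>2" by simp
  then have "sqrt (real k) \<le> (real k - 1) / 2"
    using k' by (intro real_le_lsqrt) auto
  then have "ln (sqrt (real k)) \<le> ln (ln (real n))"
    using ln_n k' by (subst ln_le_cancel_iff) auto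
  then have lnln: "ln (real k) / 2 \<le> ln (ln (real n))" using k' by (simp add: ln_sqrt)
  have "ln (real k) / 2 ^ k / 2 = (ln (real k) / 2) / 2 ^ k" by simp
  also have "\<dots> \<le> (ln (real k) / 2) / real n"
    using n2' n0 k' by (intro divide_left_mono) auto
  also have "\<dots> \<le> ln (ln (real n)) / real n"
    using lnln n0 by (intro divide_right_mono) auto
  finally show "ln (real k) / 2 ^ k / 2 \<le> ln (ln (real n)) / real n" .
qed

text \<open>The third bound lets the Erdos-Turan term 1/H with H = 2^k disappear in the rate; it
  uses ln k \<ge> 1.\<close>

lemma ln_over_power2_bounds:
  fixes k :: nat
  assumes k: "k \<ge> 6"
  shows "ln (real k) / 2 ^ k > 0" "ln (real k) / 2 ^ k \<le> 1" "1 / 2 ^ k \<le> sqrt (ln (real k) / 2 ^ k)"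
proof -
  have k': "real k \<ge> 6" using k by simp
  have "ln (real k) \<le> real k" using ln_le_minus_one[of "real k"] k' by simp
  also have "real k \<le> 2 ^ k" by (rule of_nat_less_two_power[THEN less_imp_le])
  finally show "ln (real k) / 2 ^ k \<le> 1" by simp
  have "exp 1 \<le> real k" using exp_le k' by linarith
  then have ln1: "1 \<le> ln (real k)" using k' by (subst ln_ge_iff) auto
  then show "ln (real k) / 2 ^ k > 0" by simp
  have "(1 / 2 ^ k)\<^sup>2 \<le> (1 / 2 ^ k :: real)"
    by (simp add: power2_eq_square mult_left_le divide_simps)
  also have "\<dots> \<le> ln (real k) / 2 ^ k" using ln1 by (intro divide_right_mono) auto
  finally show "1 / 2 ^ k \<le> sqrt (ln (real k) / 2 ^ k)" by (intro real_le_rsqrt)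
qed

context iid_sequence
begin

section \<open>Borel-Cantelli along dyadic scales\<close>

text \<open>The summands of \<open>V k\<close>, divided by \<open>V k\<close>, form a probability
  vector. Jensen bounds the exponential of the weighted sum by an average of exponential moments
  that all have the same bound, so the number of frequencies does not enter.\<close>

lemma AE_weighted_max_exp_sum:
  fixes \<tau> :: "nat \<Rightarrow> real" and H :: "nat \<Rightarrow> nat"
  assumes \<tau>: "\<And>h. h \<ge> 1 \<Longrightarrow> chf (\<tau> h) \<noteq> 1" and H: "\<And>k. H k \<ge> 1"
  defines "V \<equiv> \<lambda>k. \<Sum>h=1..H k. 1 / (real h * sqrt (cmod (1 - chf (\<tau> h))))"
  shows "AE \<omega> in M. eventually (\<lambda>k. (\<Sum>h=1..H k. max_exp_sum (\<tau> h) (2 ^ k) \<omega> / real h)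
           \<le> (8 * exp 4 + 2) * V k * sqrt (2 ^ k * ln (real k))) sequentially"
proof -
  define W where "W = (\<lambda>k \<omega>. \<Sum>h=1..H k. max_exp_sum (\<tau> h) (2 ^ k) \<omega> / real h)"
  \<comment> \<open>The moment bound consumes \<open>8 * exp 4\<close>; the remaining 2 leaves
    exp(-2 ln k) = 1/k^2 after Markov, which is summable.\<close>
  define A :: real where "A = 8 * exp 4 + 2"
  note [measurable] = max_exp_sum_measurable
  have W_meas [measurable]: "W k \<in> borel_measurable M" for k unfolding W_def by measurable
  have sq: "sqrt (cmod (1 - chf (\<tau> h))) > 0" if "h \<ge> 1" for h
    using \<tau>[OF that] by simp
  have V: "V k > 0" for k
    unfolding V_def using H[of k] sq by (intro sum_pos) auto
  \<comment> \<open>Without k \<ge> 2 the event at k = 1 would have threshold 0. With it, the events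
    for k = 0 and k = 1 are empty and the probability bound holds for every k.\<close>
  define E where "E = (\<lambda>k. {\<omega> \<in> space M. k \<ge> 2 \<and> W k \<omega> \<ge> A * V k * sqrt (2 ^ k * ln (real k))})"
  have E_sets: "E k \<in> sets M" for k unfolding E_def by measurable
  have prob_E: "prob (E k) \<le> 8 * exp 2 * (1 / real k ^ 2)" for k
  proof (cases "k \<ge> 2")
    case k: True
    define L where "L = ln (real k)"
    define N :: nat where "N = 2 ^ k"
    have N: "N \<ge> 1" and NR: "real N = 2 ^ k" by (auto simp: N_def)
    have L: "L > 0" using k by (simp add: L_def)
    define w where "w = (\<lambda>h. 1 / (real h * sqrt (cmod (1 - chf (\<tau> h)))) / V k)"
    have w0: "w h \<ge> 0" if "h \<in> {1..H k}" for h
      using V[of k] by (auto simp: w_def intro!: divide_nonneg_nonneg mult_nonneg_nonneg)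
    have w1: "(\<Sum>h=1..H k. w h) = 1"
      unfolding w_def sum_divide_distrib[symmetric] using V[of k] by (simp add: V_def)
    define r where "r = (\<lambda>h. sqrt (L * cmod (1 - chf (\<tau> h)) / real N))"
    define F where "F = (\<lambda>\<omega>. \<Sum>h=1..H k. w h * exp (r h * max_exp_sum (\<tau> h) N \<omega>))"
    have jensen: "exp (sqrt (L / real N) / V k * W k \<omega>) \<le> F \<omega>" for \<omega>
    proof -
      have "sqrt (L / real N) / V k * W k \<omega> = (\<Sum>h=1..H k. w h *\<^sub>R (r h * max_exp_sum (\<tau> h) N \<omega>))"
        unfolding W_def sum_distrib_left
      proof (rule sum.cong)
        fix h assume "h \<in> {1..H k}"
        then have "sqrt (cmod (1 - chf (\<tau> h))) > 0" using sq by auto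
        then show "sqrt (L / real N) / V k * (max_exp_sum (\<tau> h) (2 ^ k) \<omega> / real h) =
            w h *\<^sub>R (r h * max_exp_sum (\<tau> h) N \<omega>)"
          by (simp add: w_def r_def real_sqrt_mult real_sqrt_divide N_def)
      qed simp
      also have "exp \<dots> \<le> F \<omega>" unfolding F_def
        by (rule convex_on_sum[OF _ _ exp_convex w1]) (use H[of k] w0 in auto)
      finally show ?thesis .
    qed
    have r0: "r h \<ge> 0" for h using L by (simp add: r_def)
    have int_F: "integrable M F" unfolding F_def
      by (intro Bochner_Integration.integrable_sum integrable_mult_right integrable_exp_max_exp_sum r0)
    have EF: "expectation F \<le> 8 * exp 2 * exp (8 * exp 4 * L)"
    proof -
      have "expectation F = (\<Sum>h=1..H k. w h * expectation (\<lambda>\<omega>. exp (r h * max_exp_sum (\<tau> h) N \<omega>)))"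
        unfolding F_def using integrable_exp_max_exp_sum[OF r0]
        by (subst Bochner_Integration.integral_sum) (auto intro!: integrable_mult_right)
      also have "\<dots> \<le> (\<Sum>h=1..H k. w h * (8 * exp 2 * exp (8 * exp 4 * L)))"
        unfolding r_def using w0 L by (intro sum_mono mult_left_mono expectation_exp_max_le[OF N]) auto
      also have "\<dots> = 8 * exp 2 * exp (8 * exp 4 * L)"
        unfolding sum_distrib_right[symmetric] w1 by simp
      finally show ?thesis .
    qed
    have "E k \<subseteq> {\<omega> \<in> space M. F \<omega> \<ge> exp (A * L)}"
    proof
      fix \<omega> assume "\<omega> \<in> E k"
      then have \<omega>: "\<omega> \<in> space M" "W k \<omega> \<ge> A * V k * sqrt (real N * L)"
        by (auto simp: E_def L_def NR)
      have "A * L = sqrt (L / real N) / V k * (A * V k * sqrt (real N * L))"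
        using V[of k] L N by (simp add: real_sqrt_mult real_sqrt_divide)
      also have "\<dots> \<le> sqrt (L / real N) / V k * W k \<omega>"
        using \<omega>(2) V[of k] L by (intro mult_left_mono) auto
      finally have "exp (A * L) \<le> exp (sqrt (L / real N) / V k * W k \<omega>)" by simp
      also note jensen
      finally show "\<omega> \<in> {\<omega> \<in> space M. F \<omega> \<ge> exp (A * L)}" using \<omega>(1) by simp
    qed
    then have "prob (E k) \<le> prob {\<omega> \<in> space M. F \<omega> \<ge> exp (A * L)}"
      using int_F by (intro finite_measure_mono) auto
    also have "\<dots> \<le> expectation F / exp (A * L)"
    proof (rule integral_Markov_inequality_measure[OF int_F sets.top])
      show "AE \<omega> in M. 0 \<le> F \<omega>" unfolding F_def using w0 by (intro AE_I2 sum_nonneg mult_nonneg_nonneg) auto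
    qed simp
    also have "\<dots> \<le> 8 * exp 2 * exp (8 * exp 4 * L) / exp (A * L)"
      using EF by (intro divide_right_mono) auto
    also have "\<dots> = 8 * exp 2 * exp (- (2 * L))"
      by (simp add: A_def distrib_right exp_add exp_minus field_simps)
    also have "exp (- (2 * L)) = 1 / real k ^ 2"
      using k by (simp add: exp_minus exp_double L_def divide_inverse)
    finally show ?thesis .
  next
    case False
    then have "E k = {}" by (auto simp: E_def)
    then show ?thesis by simp
  qed
  have "summable (\<lambda>k. prob (E k))"
  proof (rule summable_comparison_test')
    show "summable (\<lambda>k. 8 * exp 2 * (1 / real k ^ 2))"
      using inverse_power_summable[of 2, where 'a=real] by (intro summable_mult) (simp add: inverse_eq_divide)
    show "norm (prob (E k)) \<le> 8 * exp 2 * (1 / real k ^ 2)" for k using prob_E[of k] by simp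
  qed
  then have "AE \<omega> in M. eventually (\<lambda>k. \<omega> \<in> space M - E k) sequentially"
    by (intro borel_cantelli_AE1 E_sets) (auto simp: emeasure_eq_measure)
  then show ?thesis
  proof eventually_elim
    case (elim \<omega>)
    have "eventually (\<lambda>k::nat. k \<ge> 2) sequentially" by (rule eventually_ge_at_top)
    with elim show ?case
      by eventually_elim (auto simp: E_def W_def A_def)
  qed
qed

text \<open>One maximum up to 2^k serves every n of the dyadic block; replacing 1/n by 2/2^k turns
  the factor 4 into 8.\<close>

lemma discrepancy_le_max_exp_sum:
  fixes n H k :: nat and \<alpha> :: real and \<omega> :: 'a
  assumes H: "H \<ge> 1" and n: "2 ^ k < 2 * n" "n \<le> 2 ^ k"
  defines "W \<equiv> \<Sum>h=1..H. max_exp_sum (2 * pi * real h * \<alpha>) (2 ^ k) \<omega> / real h"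
  shows "discrepancy n (\<lambda>k. frac ((\<Sum>j=1..k. X j \<omega>) * \<alpha>)) \<le> 16 * pi / real H + 8 * (W / 2 ^ k)"
proof -
  have W0: "W \<ge> 0" unfolding W_def using max_exp_sum_bounds(1) by (intro sum_nonneg) auto
  have n0: "n > 0" using n(1) by (cases n) auto
  have n2: "2 ^ k < 2 * real n" using n(1) by (metis of_nat_less_iff of_nat_mult of_nat_numeral of_nat_power)
  let ?x = "\<lambda>k. (\<Sum>j=1..k. X j \<omega>) * \<alpha>"
  have "discrepancy n (\<lambda>k. frac (?x k)) = discrepancy n ?x"
    by (simp add: discrepancy_def)
  \<comment> \<open>Erdos-Turan is used with H + 1 because its frequencies stay strictly below the
    parameter.\<close>
  also have "\<dots> \<le> 16 * pi / real (H + 1) +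
     4 * ((\<Sum>h=1..<H + 1. cmod (\<Sum>k=1..n. cis (2 * pi * real h * ?x k)) / real h) / (pi * real n))"
    by (rule erdos_turan[OF n0]) simp
  also have "\<dots> \<le> 16 * pi / real H + 4 * (W / (pi * real n))"
  proof (intro add_mono divide_left_mono mult_left_mono divide_right_mono)
    have "(\<Sum>k=1..n. cis (2 * pi * real h * ?x k)) = exp_sum (2 * pi * real h * \<alpha>) n \<omega>" for h
      by (simp add: exp_sum_def phase_def mult_ac)
    then have "(\<Sum>h=1..<H + 1. cmod (\<Sum>k=1..n. cis (2 * pi * real h * ?x k)) / real h) =
        (\<Sum>h=1..H. cmod (exp_sum (2 * pi * real h * \<alpha>) n \<omega>) / real h)"
      by (intro sum.cong) auto
    also have "\<dots> \<le> W"
      unfolding W_def by (intro sum_mono divide_right_mono max_exp_sum_ge[OF n(2)]) auto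
    finally show "(\<Sum>h=1..<H + 1. cmod (\<Sum>k=1..n. cis (2 * pi * real h * ?x k)) / real h) \<le> W" .
  qed (use H in auto)
  also have "4 * (W / (pi * real n)) \<le> 8 * (W / 2 ^ k)"
  proof -
    have "1 * 2 ^ k \<le> pi * (2 * real n)"
      using n2 pi_ge_two by (intro mult_mono) auto
    then have "W / (pi * (2 * real n)) \<le> W / 2 ^ k"
      using W0 n0 by (intro divide_left_mono) auto
    then show ?thesis by simp
  qed
  finally show ?thesis by simp
qed

lemma AE_discrepancy_dyadic:
  fixes \<alpha> :: real and H :: "nat \<Rightarrow> nat"
  assumes \<alpha>: "\<And>h. h \<ge> 1 \<Longrightarrow> chf (2 * pi * real h * \<alpha>) \<noteq> 1" and H: "\<And>k. H k \<ge> 1"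
  defines "V \<equiv> \<lambda>k. \<Sum>h=1..H k. 1 / (real h * sqrt (cmod (1 - chf (2 * pi * real h * \<alpha>))))"
  shows "AE \<omega> in M. eventually (\<lambda>k. \<forall>n. 2 ^ k < 2 * n \<and> n \<le> 2 ^ k \<longrightarrow>
            discrepancy n (\<lambda>k. frac ((\<Sum>j=1..k. X j \<omega>) * \<alpha>))
              \<le> 16 * pi / real (H k) + 8 * (8 * exp 4 + 2) * V k * sqrt (ln (real k) / 2 ^ k)) sequentially"
proof -
  have sqrt_eq: "sqrt (2 ^ k * y) / 2 ^ k = sqrt (y / 2 ^ k)" for y :: real and k :: nat
  proof -
    have "y / 2 ^ k = 2 ^ k * y / (2 ^ k)\<^sup>2" by (simp add: power2_eq_square)
    then show ?thesis by (simp only: real_sqrt_divide real_sqrt_abs) simp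
  qed
  have "AE \<omega> in M. eventually (\<lambda>k. (\<Sum>h=1..H k. max_exp_sum (2 * pi * real h * \<alpha>) (2 ^ k) \<omega> / real h)
           \<le> (8 * exp 4 + 2) * V k * sqrt (2 ^ k * ln (real k))) sequentially"
    unfolding V_def by (rule AE_weighted_max_exp_sum) (use \<alpha> H in auto)
  then show ?thesis
  proof eventually_elim
    case (elim \<omega>)
    then show ?case
    proof (rule eventually_mono, intro allI impI, elim conjE)
      fix k n :: nat
      define W where "W = (\<Sum>h=1..H k. max_exp_sum (2 * pi * real h * \<alpha>) (2 ^ k) \<omega> / real h)"
      assume "W \<le> (8 * exp 4 + 2) * V k * sqrt (2 ^ k * ln (real k))" and n: "2 ^ k < 2 * n" "n \<le> 2 ^ k"
      then have "8 * (W / 2 ^ k) \<le> 8 * ((8 * exp 4 + 2) * V k * sqrt (2 ^ k * ln (real k)) / 2 ^ k)"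
        by (intro mult_left_mono divide_right_mono) auto
      also have "\<dots> = 8 * (8 * exp 4 + 2) * V k * (sqrt (2 ^ k * ln (real k)) / 2 ^ k)"
        by (simp only: mult.assoc times_divide_eq_right)
      also note sqrt_eq
      finally show "discrepancy n (\<lambda>k. frac ((\<Sum>j=1..k. X j \<omega>) * \<alpha>))
              \<le> 16 * pi / real (H k) + 8 * (8 * exp 4 + 2) * V k * sqrt (ln (real k) / 2 ^ k)"
        using discrepancy_le_max_exp_sum[OF H[of k] n, of \<omega> \<alpha>] unfolding W_def by linarith
    qed
  qed
qed

text \<open>Reduces both rates to deterministic estimates: \<open>G\<close> is the rate on the
  dyadic scale, \<open>upper\<close> balances the two Erdos-Turan terms there, and
  \<open>lower\<close> passes from the scale to the individual n.\<close>

lemma discrepancy_as_bigoI: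
  fixes \<alpha> K :: real and H :: "nat \<Rightarrow> nat" and g G :: "nat \<Rightarrow> real"
  assumes \<alpha>: "\<And>h. h \<ge> 1 \<Longrightarrow> chf (2 * pi * real h * \<alpha>) \<noteq> 1" and H: "\<And>k. H k \<ge> 1"
    and upper: "\<And>k. k \<ge> kmin \<Longrightarrow> 1 / real (H k) +
        (\<Sum>h=1..H k. 1 / (real h * sqrt (cmod (1 - chf (2 * pi * real h * \<alpha>))))) * sqrt (ln (real k) / 2 ^ k) \<le> K * G k"
    and lower: "\<And>k n. k \<ge> kmin \<Longrightarrow> 2 ^ k < 2 * n \<Longrightarrow> n \<le> 2 ^ k \<Longrightarrow> 0 < G k \<and> G k \<le> g n"
    and K: "K \<ge> 0"
  shows "as_bigo M (\<lambda>n \<omega>. discrepancy n (\<lambda>k. frac ((\<Sum>j=1..k. X j \<omega>) * \<alpha>))) g"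
proof -
  have "AE \<omega> in M. eventually (\<lambda>k. \<forall>n. 2 ^ k < 2 * n \<and> n \<le> 2 ^ k \<longrightarrow>
            discrepancy n (\<lambda>k. frac ((\<Sum>j=1..k. X j \<omega>) * \<alpha>))
              \<le> 16 * pi / real (H k) + 8 * (8 * exp 4 + 2) *
              (\<Sum>h=1..H k. 1 / (real h * sqrt (cmod (1 - chf (2 * pi * real h * \<alpha>))))) * sqrt (ln (real k) / 2 ^ k)) sequentially"
    by (rule AE_discrepancy_dyadic) (use \<alpha> H in auto)
  then show ?thesis
    unfolding as_bigo_def
  proof eventually_elim
    case (elim \<omega>)
    define c :: real where "c = max (16 * pi) (8 * (8 * exp 4 + 2))"
    have c0: "c \<ge> 0" unfolding c_def by (intro max.coboundedI1) simp
    from elim obtain k1 where k1: "\<And>k n. k \<ge> k1 \<Longrightarrow> 2 ^ k < 2 * n \<Longrightarrow> n \<le> 2 ^ k \<Longrightarrow>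
        discrepancy n (\<lambda>k. frac ((\<Sum>j=1..k. X j \<omega>) * \<alpha>)) \<le> 16 * pi / real (H k) + 8 * (8 * exp 4 + 2) *
        (\<Sum>h=1..H k. 1 / (real h * sqrt (cmod (1 - chf (2 * pi * real h * \<alpha>))))) * sqrt (ln (real k) / 2 ^ k)"
      unfolding eventually_sequentially by blast
    have "eventually (\<lambda>n. ereal (discrepancy n (\<lambda>k. frac ((\<Sum>j=1..k. X j \<omega>) * \<alpha>)) / g n) \<le> ereal (c * K)) sequentially"
      unfolding eventually_sequentially
    proof (intro exI allI impI)
      fix n :: nat assume n: "2 ^ (max kmin (max k1 1)) \<le> n"
      have "n \<ge> 1" using n by (meson one_le_numeral one_le_power order_trans)
      then obtain k where k: "2 ^ k < 2 * n" "n \<le> 2 ^ k" by (rule ex_dyadic_scale)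
      have "(2::nat) ^ (max kmin (max k1 1)) \<le> 2 ^ k" using n k by linarith
      then have "max kmin (max k1 1) \<le> k" by (subst (asm) power_increasing_iff) auto
      then have kk: "k \<ge> kmin" "k \<ge> k1" "k \<ge> 1" by auto
      have g: "0 < G k" "G k \<le> g n" using lower[OF kk(1) k] by auto
      define V where "V = (\<Sum>h=1..H k. 1 / (real h * sqrt (cmod (1 - chf (2 * pi * real h * \<alpha>)))))"
      have "V \<ge> 0" unfolding V_def by (intro sum_nonneg) auto
      then have V0: "V * sqrt (ln (real k) / 2 ^ k) \<ge> 0"
        using kk by (intro mult_nonneg_nonneg) auto
      have "discrepancy n (\<lambda>k. frac ((\<Sum>j=1..k. X j \<omega>) * \<alpha>)) \<le>
          16 * pi * (1 / real (H k)) + 8 * (8 * exp 4 + 2) * (V * sqrt (ln (real k) / 2 ^ k))"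
        using k1[OF kk(2) k] by (simp add: V_def mult.assoc)
      also have "\<dots> \<le> c * (1 / real (H k)) + c * (V * sqrt (ln (real k) / 2 ^ k))"
        using V0 unfolding c_def by (intro add_mono mult_right_mono) auto
      also have "\<dots> \<le> c * (K * G k)"
        using upper[OF kk(1)] c0 unfolding distrib_left[symmetric] V_def by (intro mult_left_mono)
      also have "\<dots> \<le> c * (K * g n)"
        using g K c0 by (intro mult_left_mono)
      finally have "discrepancy n (\<lambda>k. frac ((\<Sum>j=1..k. X j \<omega>) * \<alpha>)) \<le> c * K * g n" by simp
      then show "ereal (discrepancy n (\<lambda>k. frac ((\<Sum>j=1..k. X j \<omega>) * \<alpha>)) / g n) \<le> ereal (c * K)"
        using g by (simp add: divide_le_eq)
    qed
    then have "limsup (\<lambda>n. ereal (discrepancy n (\<lambda>k. frac ((\<Sum>j=1..k. X j \<omega>) * \<alpha>)) / g n)) \<le> ereal (c * K)"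
      by (rule Limsup_bounded)
    then show ?case by (rule le_less_trans) simp
  qed
qed

section \<open>The two rates, depending on \<gamma> and \<beta>\<close>

text \<open>The factor d moves into \<alpha>' = d \<alpha>, which satisfies the same Diophantine
  condition with a smaller or equal constant. The exponent is halved to b = \<beta>/2 because the
  square root of |1 - chf| enters the weights. What remains is the choice of H in each
  range.\<close>

lemma discrepancy_as_bigo:
  fixes \<alpha> \<gamma> C \<beta> c :: real and d :: int
  assumes \<beta>: "0 < \<beta>" "\<beta> \<le> 2" and c: "c > 0" and d: "d > 0"
    and chf: "\<And>x. cmod (1 - chf (2 * pi * x)) \<ge> c * dist_int (of_int d * x) powr \<beta>"
    and \<gamma>: "\<gamma> \<ge> 1" and C: "C > 0"
    and dioph: "\<And>q::nat. q \<ge> 1 \<Longrightarrow> dist_int (real q * \<alpha>) \<ge> C * real q powr (- \<gamma>)"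
  shows "\<gamma> \<le> 2 / \<beta> \<Longrightarrow> as_bigo M (\<lambda>n \<omega>. discrepancy n (\<lambda>k. frac ((\<Sum>j=1..k. X j \<omega>) * \<alpha>)))
           (\<lambda>n. sqrt (ln (ln (real n)) / real n) * ln (real n) ^ (if \<beta> < 2 then 1 else 2))"
    and "\<gamma> > 2 / \<beta> \<Longrightarrow> as_bigo M (\<lambda>n \<omega>. discrepancy n (\<lambda>k. frac ((\<Sum>j=1..k. X j \<omega>) * \<alpha>)))
           (\<lambda>n. (ln (ln (real n)) / real n) powr (1 / (\<beta> * \<gamma>)))"
proof -
  define b where "b = \<beta> / 2"
  define \<alpha>' where "\<alpha>' = of_int d * \<alpha>"
  define C' where "C' = C * of_int d powr (- \<gamma>)"
  have b: "0 < b" "b \<le> 1" using \<beta> by (auto simp: b_def)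
  have C': "C' > 0" using C d by (simp add: C'_def)
  have dioph': "dist_int (real q * \<alpha>') \<ge> C' * real q powr (- \<gamma>)" if "q \<ge> 1" for q :: nat
  proof -
    have "1 * 1 \<le> q * nat d" using that d by (intro mult_le_mono) auto
    then have "C * real (q * nat d) powr (- \<gamma>) \<le> dist_int (real (q * nat d) * \<alpha>)"
      by (intro dioph) simp
    moreover have "real (nat d) = of_int d" using d by simp
    ultimately show ?thesis by (simp add: C'_def \<alpha>'_def powr_mult mult_ac)
  qed
  have dist_pos: "dist_int (real h * \<alpha>') > 0" if "h \<ge> 1" for h :: nat
    using dioph'[OF that] C' that by (intro less_le_trans[OF _ dioph'[OF that]]) auto
  have chf_h: "c * dist_int (real h * \<alpha>') powr \<beta> \<le> cmod (1 - chf (2 * pi * real h * \<alpha>))" for h :: nat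
    using chf[of "real h * \<alpha>"] by (simp add: \<alpha>'_def mult_ac)
  have chf_ne: "chf (2 * pi * real h * \<alpha>) \<noteq> 1" if "h \<ge> 1" for h :: nat
  proof -
    have "c * dist_int (real h * \<alpha>') powr \<beta> > 0" using dist_pos[OF that] c by simp
    then show ?thesis using chf_h[of h] by auto
  qed
  have V_le: "(\<Sum>h=1..H. 1 / (real h * sqrt (cmod (1 - chf (2 * pi * real h * \<alpha>))))) \<le>
      1 / sqrt c * (\<Sum>h=1..H. dist_int (real h * \<alpha>') powr (- b) / real h)" for H :: nat
    unfolding sum_distrib_left
  proof (rule sum_mono)
    fix h assume "h \<in> {1..H}"
    then have h: "h \<ge> 1" by simp
    let ?D = "dist_int (real h * \<alpha>')"
    have D: "?D > 0" by (rule dist_pos[OF h])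
    have "sqrt c * ?D powr b = sqrt (c * ?D powr \<beta>)"
      using D by (simp add: real_sqrt_mult powr_half_sqrt[symmetric] powr_powr b_def)
    also have "\<dots> \<le> sqrt (cmod (1 - chf (2 * pi * real h * \<alpha>)))"
      using chf_h by (rule real_sqrt_le_mono)
    finally have "real h * (sqrt c * ?D powr b) \<le> real h * sqrt (cmod (1 - chf (2 * pi * real h * \<alpha>)))"
      by (rule mult_left_mono) simp
    then have "1 / (real h * sqrt (cmod (1 - chf (2 * pi * real h * \<alpha>)))) \<le> 1 / (real h * (sqrt c * ?D powr b))"
      using h c D by (intro divide_left_mono mult_pos_pos) (auto simp: chf_ne[OF h])
    also have "\<dots> = 1 / sqrt c * (?D powr (- b) / real h)"
      by (simp add: powr_minus divide_simps)
    finally show "1 / (real h * sqrt (cmod (1 - chf (2 * pi * real h * \<alpha>)))) \<le> 1 / sqrt c * (?D powr (- b) / real h)" .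
  qed
  show "as_bigo M (\<lambda>n \<omega>. discrepancy n (\<lambda>k. frac ((\<Sum>j=1..k. X j \<omega>) * \<alpha>)))
           (\<lambda>n. sqrt (ln (ln (real n)) / real n) * ln (real n) ^ (if \<beta> < 2 then 1 else 2))"
    if \<gamma>\<beta>: "\<gamma> \<le> 2 / \<beta>"
  proof -
    define s :: nat where "s = (if \<beta> < 2 then 1 else 2)"
    obtain K where K: "K > 0"
      "\<And>H. H \<ge> 1 \<Longrightarrow> (\<Sum>h=1..H. dist_int (real h * \<alpha>') powr (- b) / real h) \<le> K * (1 + ln (real H)) ^ s"
    proof (cases "\<beta> < 2")
      case True
      have "\<gamma> * b \<le> 1" using \<gamma>\<beta> \<beta> by (simp add: b_def field_simps)
      moreover have "b < 1" using True by (simp add: b_def)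
      ultimately obtain K where "K > 0"
        "\<And>H. H \<ge> 1 \<Longrightarrow> (\<Sum>h=1..H. dist_int (real h * \<alpha>') powr (- b) / real h) \<le> K * (1 + ln (real H))"
        using weighted_dist_int_sum_log[OF C' b(1) _ _ dioph'] by metis
      then show ?thesis using that True by (simp add: s_def)
    next
      case False
      \<comment> \<open>Now \<gamma> \<le> 2/\<beta> = 1 and \<gamma> \<ge> 1 leave only \<gamma> =
        1, the critical case with the squared logarithm.\<close>
      then have \<beta>2: "\<beta> = 2" using \<beta> by simp
      then have "\<gamma> = 1" using \<gamma>\<beta> \<gamma> by simp
      then have "dist_int (real q * \<alpha>') \<ge> C' * real q powr (- 1)" if "q \<ge> 1" for q :: nat
        using dioph'[OF that] by simp
      then obtain K where "K > 0"
        "\<And>H. H \<ge> 1 \<Longrightarrow> (\<Sum>h=1..H. dist_int (real h * \<alpha>') powr (- 1) / real h) \<le> K * (1 + ln (real H))\<^sup>2"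
        by (rule weighted_dist_int_sum_log2[OF C']) auto
      then show ?thesis using that \<beta>2 by (simp add: s_def b_def)
    qed
    show ?thesis unfolding s_def[symmetric]
    \<comment> \<open>With H = 2^k the term 1/H is negligible and 1 + ln H \<le> 2k. The factors 1/2
      and 1/4 in \<open>G\<close> come from \<open>dyadic_ln_bounds\<close>;
      \<open>8 ^ s * sqrt 2\<close> undoes them, taking k/4 back to 2k.\<close>
    proof (rule discrepancy_as_bigoI[where H="\<lambda>k. 2 ^ k" and kmin=6 and
          G="\<lambda>k. sqrt (ln (real k) / 2 ^ k / 2) * (real k / 4) ^ s" and
          K="(1 + 1 / sqrt c * K) * (8 ^ s * sqrt 2)"])
      show "chf (2 * pi * real h * \<alpha>) \<noteq> 1" if "h \<ge> 1" for h using chf_ne[OF that] .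
      show "(1 + 1 / sqrt c * K) * (8 ^ s * sqrt 2) \<ge> 0" using c K by simp
      show "0 < sqrt (ln (real k) / 2 ^ k / 2) * (real k / 4) ^ s \<and>
          sqrt (ln (real k) / 2 ^ k / 2) * (real k / 4) ^ s \<le> sqrt (ln (ln (real n)) / real n) * ln (real n) ^ s"
        if "6 \<le> k" "2 ^ k < 2 * n" "n \<le> 2 ^ k" for k n
      proof
        note bd = dyadic_ln_bounds[OF that]
        have x: "ln (real k) / 2 ^ k > 0" by (rule ln_over_power2_bounds[OF that(1)])
        then show "0 < sqrt (ln (real k) / 2 ^ k / 2) * (real k / 4) ^ s"
          using that(1) by (intro mult_pos_pos) auto
        show "sqrt (ln (real k) / 2 ^ k / 2) * (real k / 4) ^ s \<le> sqrt (ln (ln (real n)) / real n) * ln (real n) ^ s"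
          using bd x by (intro mult_mono real_sqrt_le_mono power_mono) auto
      qed
      show "1 / real (2 ^ k) + (\<Sum>h = 1..2 ^ k. 1 / (real h * sqrt (cmod (1 - chf (2 * pi * real h * \<alpha>))))) *
            sqrt (ln (real k) / 2 ^ k) \<le> (1 + 1 / sqrt c * K) * (8 ^ s * sqrt 2) * (sqrt (ln (real k) / 2 ^ k / 2) * (real k / 4) ^ s)"
        if k: "6 \<le> k" for k
      proof -
        define x where "x = ln (real k) / 2 ^ k"
        note xb = ln_over_power2_bounds[OF k, folded x_def]
        have "(1 + ln (real (2 ^ k))) ^ s \<le> (2 * real k) ^ s"
        proof (rule power_mono)
          have "ln (2::real) \<le> 1" using ln_le_minus_one[of "2::real"] by simp
          then have "real k * ln 2 \<le> real k" by (intro mult_left_le) auto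
          moreover have "ln (real (2 ^ k)) = real k * ln 2" by (simp add: ln_realpow)
          moreover have "1 \<le> real k" using k by simp
          ultimately show "1 + ln (real (2 ^ k)) \<le> 2 * real k" by linarith
        qed simp
        then have "K * (1 + ln (real (2 ^ k))) ^ s \<le> K * (2 * real k) ^ s"
          using K(1) by (intro mult_left_mono) auto
        then have "(\<Sum>h=1..2 ^ k. dist_int (real h * \<alpha>') powr (- b) / real h) \<le> K * (2 * real k) ^ s"
          by (intro order_trans[OF K(2)]) auto
        then have "1 / sqrt c * (\<Sum>h=1..2 ^ k. dist_int (real h * \<alpha>') powr (- b) / real h) \<le> 1 / sqrt c * (K * (2 * real k) ^ s)"
          using c by (intro mult_left_mono) auto
        then have V: "(\<Sum>h = 1..2 ^ k. 1 / (real h * sqrt (cmod (1 - chf (2 * pi * real h * \<alpha>))))) \<le> 1 / sqrt c * K * (2 * real k) ^ s"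
          using V_le[of "2 ^ k"] by simp
        have one: "1 \<le> (2 * real k) ^ s" using k by (intro one_le_power) auto
        have "1 / real (2 ^ k) \<le> 1 * sqrt x" using xb(3) by simp
        also have "\<dots> \<le> (2 * real k) ^ s * sqrt x" using one xb(1) by (intro mult_right_mono) auto
        finally have "1 / real (2 ^ k) + (\<Sum>h = 1..2 ^ k. 1 / (real h * sqrt (cmod (1 - chf (2 * pi * real h * \<alpha>))))) * sqrt x
            \<le> (2 * real k) ^ s * sqrt x + (1 / sqrt c * K * (2 * real k) ^ s) * sqrt x"
          using V xb(1) by (intro add_mono mult_right_mono) auto
        also have "\<dots> = (1 + 1 / sqrt c * K) * ((2 * real k) ^ s * sqrt x)"
          by (simp add: algebra_simps)
        also have "(2 * real k) ^ s * sqrt x = (8 ^ s * (real k / 4) ^ s) * (sqrt 2 * sqrt (x / 2))"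
          by (subst power_mult_distrib[symmetric], subst real_sqrt_mult[symmetric]) simp
        finally show ?thesis by (simp add: x_def mult_ac)
      qed
    qed simp_all
  qed
  show "as_bigo M (\<lambda>n \<omega>. discrepancy n (\<lambda>k. frac ((\<Sum>j=1..k. X j \<omega>) * \<alpha>)))
           (\<lambda>n. (ln (ln (real n)) / real n) powr (1 / (\<beta> * \<gamma>)))"
    if \<gamma>\<beta>: "\<gamma> > 2 / \<beta>"
  proof -
    define p where "p = 1 / (\<beta> * \<gamma>)"
    have p: "p > 0" using \<beta> \<gamma> by (simp add: p_def)
    have e: "\<gamma> * b > 1" using \<gamma>\<beta> \<beta> by (simp add: b_def field_simps)
    have pe: "p * (\<gamma> * b) = 1 / 2" using \<beta> \<gamma> by (simp add: p_def b_def)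
    obtain K where K: "K > 0"
      "\<And>H. H \<ge> 1 \<Longrightarrow> (\<Sum>h=1..H. dist_int (real h * \<alpha>') powr (- b) / real h) \<le> K * real H powr (\<gamma> * b - 1)"
      by (rule weighted_dist_int_sum_powr[OF C' b e dioph']) auto
    define x where "x = (\<lambda>k::nat. ln (real k) / 2 ^ k)"
    \<comment> \<open>H = x^(-p) balances 1/H against H^(\<gamma> b - 1) sqrt x, since p \<gamma> b
      = 1/2. For k \<ge> 6 one has x^(-p) \<ge> 1, so rounding up at most doubles it;
      \<open>max 1\<close> covers small k, where \<open>x k\<close> may be 0.\<close>
    define H where "H = (\<lambda>k. max 1 (nat \<lceil>x k powr (- p)\<rceil>))"
    show ?thesis unfolding p_def[symmetric]
    proof (rule discrepancy_as_bigoI[where H=H and kmin=6 and G="\<lambda>k. (x k / 2) powr p" and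
          K="(1 + 1 / sqrt c * K * 2 powr (\<gamma> * b - 1)) * 2 powr p"])
      show "chf (2 * pi * real h * \<alpha>) \<noteq> 1" if "h \<ge> 1" for h using chf_ne[OF that] .
      show "H k \<ge> 1" for k by (simp add: H_def)
      show "(1 + 1 / sqrt c * K * 2 powr (\<gamma> * b - 1)) * 2 powr p \<ge> 0" using c K by simp
      show "0 < (x k / 2) powr p \<and> (x k / 2) powr p \<le> (ln (ln (real n)) / real n) powr p"
        if "6 \<le> k" "2 ^ k < 2 * n" "n \<le> 2 ^ k" for k n
        using dyadic_ln_bounds(2)[OF that] ln_over_power2_bounds(1)[OF that(1)] p
        by (auto simp: x_def intro!: powr_mono2)
      show "1 / real (H k) + (\<Sum>h = 1..H k. 1 / (real h * sqrt (cmod (1 - chf (2 * pi * real h * \<alpha>))))) *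
            sqrt (ln (real k) / 2 ^ k) \<le> (1 + 1 / sqrt c * K * 2 powr (\<gamma> * b - 1)) * 2 powr p * (x k / 2) powr p"
        if k: "6 \<le> k" for k
      proof -
        have xb: "x k > 0" "x k \<le> 1"
          unfolding x_def by (rule ln_over_power2_bounds[OF k])+
        define y where "y = x k powr (- p)"
        have "x k powr 0 \<le> x k powr (- p)" using xb p by (intro powr_mono') auto
        then have y1: "y \<ge> 1" using xb(1) by (simp add: y_def)
        have H1: "real (H k) \<ge> y" "real (H k) \<le> 2 * y"
          using y1 unfolding H_def y_def[symmetric] by linarith+
        have "1 / real (H k) \<le> 1 / y" using H1 y1 by (intro divide_left_mono mult_pos_pos) auto
        also have "1 / y = x k powr p" by (simp add: y_def powr_minus_divide)
        finally have A: "1 / real (H k) \<le> x k powr p" .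
        have "real (H k) powr (\<gamma> * b - 1) \<le> (2 * y) powr (\<gamma> * b - 1)"
          using H1 e by (intro powr_mono2) auto
        also have "\<dots> = 2 powr (\<gamma> * b - 1) * x k powr (- p * (\<gamma> * b - 1))"
          using xb(1) y1 by (simp add: y_def powr_mult powr_powr)
        finally have "K * real (H k) powr (\<gamma> * b - 1) \<le> K * (2 powr (\<gamma> * b - 1) * x k powr (- p * (\<gamma> * b - 1)))"
          using K(1) by (intro mult_left_mono) auto
        with K(2)[of "H k"] have "(\<Sum>h=1..H k. dist_int (real h * \<alpha>') powr (- b) / real h) \<le> K * (2 powr (\<gamma> * b - 1) * x k powr (- p * (\<gamma> * b - 1)))"
          by (simp add: H_def)
        then have "1 / sqrt c * (\<Sum>h=1..H k. dist_int (real h * \<alpha>') powr (- b) / real h) \<le>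
            1 / sqrt c * (K * (2 powr (\<gamma> * b - 1) * x k powr (- p * (\<gamma> * b - 1))))"
          using c by (intro mult_left_mono) auto
        with V_le[of "H k"] have "(\<Sum>h = 1..H k. 1 / (real h * sqrt (cmod (1 - chf (2 * pi * real h * \<alpha>))))) \<le>
            1 / sqrt c * (K * (2 powr (\<gamma> * b - 1) * x k powr (- p * (\<gamma> * b - 1))))"
          by (rule order_trans)
        then have "(\<Sum>h = 1..H k. 1 / (real h * sqrt (cmod (1 - chf (2 * pi * real h * \<alpha>))))) * sqrt (x k) \<le>
            1 / sqrt c * (K * (2 powr (\<gamma> * b - 1) * x k powr (- p * (\<gamma> * b - 1)))) * sqrt (x k)"
          using xb(1) by (intro mult_right_mono) auto
        also have "\<dots> = 1 / sqrt c * K * 2 powr (\<gamma> * b - 1) * (x k powr (- p * (\<gamma> * b - 1)) * x k powr (1/2))"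
          using xb(1) by (simp add: powr_half_sqrt)
        also have "x k powr (- p * (\<gamma> * b - 1)) * x k powr (1/2) = x k powr p"
        proof -
          have "- p * (\<gamma> * b - 1) + 1/2 = p - p * (\<gamma> * b) + 1/2" by (simp add: algebra_simps)
          then have "- p * (\<gamma> * b - 1) + 1/2 = p" unfolding pe by simp
          then show ?thesis by (simp only: powr_add[symmetric])
        qed
        finally have "1 / real (H k) + (\<Sum>h = 1..H k. 1 / (real h * sqrt (cmod (1 - chf (2 * pi * real h * \<alpha>))))) * sqrt (x k)
            \<le> x k powr p + 1 / sqrt c * K * 2 powr (\<gamma> * b - 1) * x k powr p"
          using A by linarith
        also have "\<dots> = (1 + 1 / sqrt c * K * 2 powr (\<gamma> * b - 1)) * x k powr p"
          by (simp add: distrib_right)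
        also have "x k powr p = 2 powr p * (x k / 2) powr p"
          using xb(1) by (subst powr_mult[symmetric]) auto
        finally show ?thesis by (simp add: x_def mult_ac)
      qed
    qed
  qed
qed

end

section \<open>Specialisation to the two hypotheses on the characteristic function\<close>

theorem theorem2p3:
  fixes M :: "'a measure"
    and X S :: "nat \<Rightarrow> 'a \<Rightarrow> real"
    and \<phi> :: "real \<Rightarrow> complex"
    and \<alpha> \<gamma> C :: real
  assumes "prob_space M"
    and "prob_space.indep_vars M (\<lambda>_. borel) X {1..}"
    and "\<And>j. j \<ge> 1 \<Longrightarrow> distr M borel (X j) = distr M borel (X 1)"
    and "\<And>t. \<phi> t = char (distr M borel (X 1)) t"
    and "\<And>k \<omega>. S k \<omega> = (\<Sum>j = 1..k. X j \<omega>)"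
    and "\<alpha> \<notin> \<rat>"
    and "\<gamma> \<ge> 1" and "C > 0"
    and "\<And>q::nat. q \<ge> 1 \<Longrightarrow> dist_int (real q * \<alpha>) \<ge> C * real q powr (- \<gamma>)"
  shows "(\<forall>(\<beta>::real) (c::real) (d::int) (s::nat).
            0 < \<beta> \<and> \<beta> \<le> 2 \<and> c > 0 \<and> d > 0 \<and>
            (\<forall>x::real. 1 - cmod (\<phi> (2 * pi * x)) \<ge> c * dist_int (of_int d * x) powr \<beta>) \<and>
            s = (if \<beta> < 2 then 1 else 2) \<longrightarrow>
            (\<gamma> \<le> 2 / \<beta> \<longrightarrow>
               as_bigo M (\<lambda>N \<omega>. discrepancy N (\<lambda>k. frac (S k \<omega> * \<alpha>)))
                 (\<lambda>N. sqrt (ln (ln (real N)) / real N) * ln (real N) ^ s)) \<and>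
            (\<gamma> > 2 / \<beta> \<longrightarrow>
               as_bigo M (\<lambda>N \<omega>. discrepancy N (\<lambda>k. frac (S k \<omega> * \<alpha>)))
                 (\<lambda>N. (ln (ln (real N)) / real N) powr (1 / (\<beta> * \<gamma>)))))
       \<and> ((\<exists>(c::real) (d::int). c > 0 \<and> d > 0 \<and>
            (\<forall>x y::real. cmod (\<phi> (2 * pi * x) - \<phi> (2 * pi * y))
                           \<ge> c * dist_int (of_int d * (x - y)))) \<longrightarrow>
            (\<gamma> \<le> 2 \<longrightarrow>
               as_bigo M (\<lambda>N \<omega>. discrepancy N (\<lambda>k. frac (S k \<omega> * \<alpha>)))
                 (\<lambda>N. sqrt (ln (ln (real N)) / real N) * ln (real N))) \<and>
            (\<gamma> > 2 \<longrightarrow>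
               as_bigo M (\<lambda>N \<omega>. discrepancy N (\<lambda>k. frac (S k \<omega> * \<alpha>)))
                 (\<lambda>N. (ln (ln (real N)) / real N) powr (1 / \<gamma>))))"
proof -
  interpret iid_sequence M X
    unfolding iid_sequence_def iid_sequence_axioms_def using assms(1-3) by blast
  have \<phi>: "\<phi> t = chf t" for t by (simp add: assms(4) chf_def)
  note bigo = discrepancy_as_bigo[OF _ _ _ _ _ assms(7,8,9), folded assms(5)]
  show ?thesis
  proof (intro conjI allI impI; (elim conjE exE)?)
    fix \<beta> c :: real and d :: int and s :: nat
    assume \<beta>: "0 < \<beta>" "\<beta> \<le> 2" and c: "c > 0" and d: "d > 0" and s: "s = (if \<beta> < 2 then 1 else 2)"
      and *: "\<forall>x::real. 1 - cmod (\<phi> (2 * pi * x)) \<ge> c * dist_int (of_int d * x) powr \<beta>"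
    \<comment> \<open>The triangle inequality 1 - |z| \<le> |1 - z| reduces the first hypothesis to
      the common one.\<close>
    have chf: "c * dist_int (of_int d * x) powr \<beta> \<le> cmod (1 - chf (2 * pi * x))" for x
      using *[rule_format, of x] norm_triangle_ineq2[of 1 "chf (2 * pi * x)"] by (simp add: \<phi>)
    show "as_bigo M (\<lambda>N \<omega>. discrepancy N (\<lambda>k. frac (S k \<omega> * \<alpha>)))
        (\<lambda>N. sqrt (ln (ln (real N)) / real N) * ln (real N) ^ s)" if "\<gamma> \<le> 2 / \<beta>"
      unfolding s by (rule bigo(1)[OF \<beta> c d chf _ that])
    show "as_bigo M (\<lambda>N \<omega>. discrepancy N (\<lambda>k. frac (S k \<omega> * \<alpha>)))
        (\<lambda>N. (ln (ln (real N)) / real N) powr (1 / (\<beta> * \<gamma>)))" if "\<gamma> > 2 / \<beta>"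
      by (rule bigo(2)[OF \<beta> c d chf _ that])
  next
    fix c :: real and d :: int
    assume c: "c > 0" and d: "d > 0"
      and *: "\<forall>x y::real. cmod (\<phi> (2 * pi * x) - \<phi> (2 * pi * y)) \<ge> c * dist_int (of_int d * (x - y))"
    have chf0: "chf 0 = 1" by (simp add: chf_eq prob_space)
    have dist0: "dist_int t \<ge> 0" for t by (simp add: dist_int_def infdist_nonneg)
    \<comment> \<open>Taking y = 0, where the characteristic function is 1, gives the common
      hypothesis with \<beta> = 1. The threshold 2/\<beta> is then 2 and the logarithm has exponent
      1.\<close>
    have chf: "c * dist_int (of_int d * x) powr 1 \<le> cmod (1 - chf (2 * pi * x))" for x
      using *[rule_format, of x 0] dist0[of "of_int d * x"] by (simp add: \<phi> chf0 norm_minus_commute)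
    show "as_bigo M (\<lambda>N \<omega>. discrepancy N (\<lambda>k. frac (S k \<omega> * \<alpha>)))
        (\<lambda>N. sqrt (ln (ln (real N)) / real N) * ln (real N))" if "\<gamma> \<le> 2"
      using bigo(1)[OF _ _ c d chf] that by simp
    show "as_bigo M (\<lambda>N \<omega>. discrepancy N (\<lambda>k. frac (S k \<omega> * \<alpha>)))
        (\<lambda>N. (ln (ln (real N)) / real N) powr (1 / \<gamma>))" if "\<gamma> > 2"
      using bigo(2)[OF _ _ c d chf] that by simp
  qed
qed

end
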